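(* Let $f$ and $g$ be representable positive functionals on a $^*$-algebra $\mathscr{A}$, with associated GNS-triples $(H_f,\pi_f,\zeta_f)$ and $(H_g,\pi_g,\zeta_g)$, respectively. Let $\mathfrak{M}$ denote the closure of $$\{\pi_f(a)\zeta_f\oplus\pi_g(a)\zeta_g : a\in\mathscr{A}\}\subseteq H_f\oplus H_g.$$ Then the following assertions are equivalent: (i) $f:g=0$; (ii) $\zeta_f\oplus0\in\mathfrak{M}$; (iii) $0\oplus\zeta_g\in\mathfrak{M}$; (iv) $\mathfrak{M}=H_f\oplus H_g$; (v) $\zeta_f\oplus\zeta_g$ is a cyclic vector for $\pi_f\oplus\pi_g$; (vi) $f$ and $g$ are mutually singular; (vii) $g$ is $f$-semisingular; (viii) $f$ is $g$-semisingular.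
   Context: $\mathscr{A}$ is a complex, not necessarily unital $^*$-algebra. A linear functional $f$ on $\mathscr{A}$ is positive if $f(a^*a)\ge0$ for all $a\in\mathscr{A}$, and representable if there are a Hilbert space $H$, a $^*$-representation $\pi$ of $\mathscr{A}$ in $\mathscr{B}(H)$ and $\zeta\in H$ with $f(a)=(\pi(a)\zeta\mid\zeta)$ for all $a\in\mathscr{A}$. The GNS-triple $(H_f,\pi_f,\zeta_f)$ of a representable positive functional $f$ consists of a Hilbert space $H_f$, a $^*$-representation $\pi_f:\mathscr{A}\to\mathscr{B}(H_f)$ and a cyclic vector $\zeta_f\in H_f$ (i.e. $\{\pi_f(a)\zeta_f:a\in\mathscr{A}\}$ is dense in $H_f$) such that $f(a)=(\pi_f(a)\zeta_f\mid\zeta_f)_f$ for all $a\in\mathscr{A}$. The parallel sum $f:g$ is the representable positive functional $$(f:g)(a):=((\pi_f\oplus\pi_g)(a)P(\zeta_f\oplus0)\mid P(\zeta_f\oplus0)),\qquad a\in\mathscr{A},$$ where $P$ is the orthogonal projection of $H_f\oplus H_g$ onto $\mathfrak{M}^{\perp}$; it satisfies $(f:g)(a^*a)=\inf\{f((a-b)^*(a-b))+g(b^*b):b\in\mathscr{A}\}$ for all $a\in\mathscr{A}$. For representable functionals, $h\le f$ ($h$ is dominated by $f$) means $h(a^*a)\le f(a^*a)$ for all $a\in\mathscr{A}$. $f$ and $g$ are mutually singular if $h=0$ is the only representable functional with $h\le f$ and $h\le g$. $g$ is $f$-semisingular if there exists a sequence $(a_n)_{n\in\mathbb{N}}$ in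 $\mathscr{A}$ such that $f(a_n^*a_n)\to0$ as $n\to\infty$, $g((a_n-a_m)^*(a_n-a_m))\to0$ as $n,m\to\infty$, and $g(a_n^*a)\to g(a)$ for every $a\in\mathscr{A}$. *)

theory Defs
  imports
    "HOL-Analysis.Analysis"
    "HOL-Library.Function_Algebras"
    "HOL-Library.Complex_Order"
begin

section \<open>Complex vector spaces and complex \<open>*\<close>-algebras\<close>

class scaleC =
  fixes scaleC :: "complex \<Rightarrow> 'a \<Rightarrow> 'a"  (infixr \<open>*\<^sub>C\<close> 75)

class complex_vector = scaleC + ab_group_add +
  assumes scaleC_add_right: "c *\<^sub>C (x + y) = c *\<^sub>C x + c *\<^sub>C y"
    and scaleC_add_left: "(c + d) *\<^sub>C x = c *\<^sub>C x + d *\<^sub>C x"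
    and scaleC_scaleC: "c *\<^sub>C d *\<^sub>C x = (c * d) *\<^sub>C x"
    and scaleC_one: "1 *\<^sub>C x = x"

global_interpretation complex_vector: vector_space "scaleC :: complex \<Rightarrow> 'a \<Rightarrow> 'a::complex_vector"
  by unfold_locales
    (simp_all add: scaleC_add_right scaleC_add_left scaleC_scaleC scaleC_one)

instantiation complex :: complex_vector
begin
definition scaleC_complex :: "complex \<Rightarrow> complex \<Rightarrow> complex"
  where "scaleC_complex = (*)"
instance
  by intro_classes (simp_all add: scaleC_complex_def algebra_simps)
end

instantiation prod :: (complex_vector, complex_vector) complex_vector
begin
definition scaleC_prod :: "complex \<Rightarrow> 'a \<times> 'b \<Rightarrow> 'a \<times> 'b"
  where "scaleC_prod c x = (c *\<^sub>C fst x, c *\<^sub>C snd x)"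
instance
  by intro_classes
    (simp_all add: scaleC_prod_def scaleC_add_right scaleC_add_left scaleC_scaleC scaleC_one)
end

instantiation "fun" :: (type, complex_vector) complex_vector
begin
definition scaleC_fun :: "complex \<Rightarrow> ('a \<Rightarrow> 'b) \<Rightarrow> 'a \<Rightarrow> 'b"
  where "scaleC_fun c f = (\<lambda>x. c *\<^sub>C f x)"
instance
  by intro_classes
    (simp_all add: scaleC_fun_def fun_eq_iff scaleC_add_right scaleC_add_left scaleC_scaleC
      scaleC_one)
end

text \<open>The class \<open>ring\<close> does not assume a unit.\<close>

class star_algebra = complex_vector + ring +
  fixes star :: "'a \<Rightarrow> 'a"  (\<open>_\<^sup>\<star>\<close> [1000] 999)
  assumes mult_scaleC_left: "(c *\<^sub>C a) * b = c *\<^sub>C (a * b)"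
    and mult_scaleC_right: "a * (c *\<^sub>C b) = c *\<^sub>C (a * b)"
    and star_star: "(a\<^sup>\<star>)\<^sup>\<star> = a"
    and star_add: "(a + b)\<^sup>\<star> = a\<^sup>\<star> + b\<^sup>\<star>"
    and star_scaleC: "(c *\<^sub>C a)\<^sup>\<star> = cnj c *\<^sub>C a\<^sup>\<star>"
    and star_mult: "(a * b)\<^sup>\<star> = b\<^sup>\<star> * a\<^sup>\<star>"


section \<open>Hilbert spaces with explicit carriers\<close>

text \<open>
  A Hilbert space is given by a linear subspace of an ambient complex vector space together with
  an inner product on that subspace; nothing is required of the inner product outside the
  carrier.  Carriers are explicit because representability of a functional involves an
  existential quantification over Hilbert spaces.  The inner product is linear in its
  first argument.
\<close>

record 'v hspace =
  hcarrier :: "'v set"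
  hinner :: "'v \<Rightarrow> 'v \<Rightarrow> complex"

definition hnorm :: "('v, 'm) hspace_scheme \<Rightarrow> 'v \<Rightarrow> real"
  where "hnorm H x = sqrt (Re (hinner H x x))"

text \<open>The value outside the carrier is irrelevant; it is fixed because the locale
  \<open>Metric_space\<close> asks for a nonnegative symmetric function on the whole type.\<close>

definition hdist :: "('v::complex_vector, 'm) hspace_scheme \<Rightarrow> 'v \<Rightarrow> 'v \<Rightarrow> real"
  where "hdist H x y =
    (if x \<in> hcarrier H \<and> y \<in> hcarrier H then hnorm H (x - y) else 0)"

abbreviation htopology :: "('v::complex_vector, 'm) hspace_scheme \<Rightarrow> 'v topology"
  where "htopology H \<equiv> Metric_space.mtopology (hcarrier H) (hdist H)"

locale pre_hilbert_space =
  fixes H :: "('v::complex_vector, 'm) hspace_scheme"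
  assumes subspace: "complex_vector.subspace (hcarrier H)"
    and hinner_add_left:
      "\<lbrakk>x \<in> hcarrier H; y \<in> hcarrier H; z \<in> hcarrier H\<rbrakk>
        \<Longrightarrow> hinner H (x + y) z = hinner H x z + hinner H y z"
    and hinner_scaleC_left:
      "\<lbrakk>x \<in> hcarrier H; y \<in> hcarrier H\<rbrakk> \<Longrightarrow> hinner H (c *\<^sub>C x) y = c * hinner H x y"
    and hinner_commute:
      "\<lbrakk>x \<in> hcarrier H; y \<in> hcarrier H\<rbrakk> \<Longrightarrow> hinner H x y = cnj (hinner H y x)"
    and hinner_pos: "\<lbrakk>x \<in> hcarrier H; x \<noteq> 0\<rbrakk> \<Longrightarrow> 0 < hinner H x x"

locale hilbert_space = pre_hilbert_space +
  assumes complete: "Metric_space.mcomplete (hcarrier H) (hdist H)"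

definition orth_complement :: "('v, 'm) hspace_scheme \<Rightarrow> 'v set \<Rightarrow> 'v set"
  where "orth_complement H S = {x \<in> hcarrier H. \<forall>y\<in>S. hinner H x y = 0}"

text \<open>Meaningful for a closed subspace \<open>S\<close> of the Hilbert space \<open>H\<close> and \<open>x\<close> in \<open>H\<close>.\<close>

definition orth_projection :: "('v::complex_vector, 'm) hspace_scheme \<Rightarrow> 'v set \<Rightarrow> 'v \<Rightarrow> 'v"
  where "orth_projection H S x = (THE p. p \<in> S \<and> x - p \<in> orth_complement H S)"

definition direct_sum :: "'v hspace \<Rightarrow> 'w hspace \<Rightarrow> ('v \<times> 'w) hspace"  (infixr \<open>\<oplus>\<^sub>H\<close> 65)
  where "H \<oplus>\<^sub>H K =
    \<lparr>hcarrier = hcarrier H \<times> hcarrier K,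
     hinner = (\<lambda>x y. hinner H (fst x) (fst y) + hinner K (snd x) (snd y))\<rparr>"


section \<open>Representations\<close>

definition bounded_operator :: "'v::complex_vector hspace \<Rightarrow> ('v \<Rightarrow> 'v) \<Rightarrow> bool"
  where "bounded_operator H T \<longleftrightarrow>
    (\<forall>x\<in>hcarrier H. T x \<in> hcarrier H) \<and>
    (\<forall>x\<in>hcarrier H. \<forall>y\<in>hcarrier H. T (x + y) = T x + T y) \<and>
    (\<forall>c. \<forall>x\<in>hcarrier H. T (c *\<^sub>C x) = c *\<^sub>C T x) \<and>
    (\<exists>C. \<forall>x\<in>hcarrier H. hnorm H (T x) \<le> C * hnorm H x)"

definition star_representation ::
    "'v::complex_vector hspace \<Rightarrow> ('a::star_algebra \<Rightarrow> 'v \<Rightarrow> 'v) \<Rightarrow> bool"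
  where "star_representation H \<pi> \<longleftrightarrow>
    (\<forall>a. bounded_operator H (\<pi> a)) \<and>
    (\<forall>a b. \<forall>x\<in>hcarrier H. \<pi> (a + b) x = \<pi> a x + \<pi> b x) \<and>
    (\<forall>c a. \<forall>x\<in>hcarrier H. \<pi> (c *\<^sub>C a) x = c *\<^sub>C \<pi> a x) \<and>
    (\<forall>a b. \<forall>x\<in>hcarrier H. \<pi> (a * b) x = \<pi> a (\<pi> b x)) \<and>
    (\<forall>a. \<forall>x\<in>hcarrier H. \<forall>y\<in>hcarrier H. hinner H (\<pi> (a\<^sup>\<star>) x) y = hinner H x (\<pi> a y))"

definition cyclic_vector ::
    "'v::complex_vector hspace \<Rightarrow> ('a::star_algebra \<Rightarrow> 'v \<Rightarrow> 'v) \<Rightarrow> 'v \<Rightarrow> bool"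
  where "cyclic_vector H \<pi> \<zeta> \<longleftrightarrow>
    \<zeta> \<in> hcarrier H \<and> htopology H closure_of {\<pi> a \<zeta> |a. True} = hcarrier H"

definition rep_sum ::
    "('a \<Rightarrow> 'v \<Rightarrow> 'v) \<Rightarrow> ('a \<Rightarrow> 'w \<Rightarrow> 'w) \<Rightarrow> 'a \<Rightarrow> 'v \<times> 'w \<Rightarrow> 'v \<times> 'w"  (infixr \<open>\<oplus>\<^sub>r\<close> 65)
  where "(\<pi> \<oplus>\<^sub>r \<rho>) a = map_prod (\<pi> a) (\<rho> a)"


section \<open>Positive and representable functionals\<close>

definition positive_functional :: "('a::star_algebra \<Rightarrow> complex) \<Rightarrow> bool"
  where "positive_functional f \<longleftrightarrow>
    Vector_Spaces.linear scaleC (*) f \<and> (\<forall>a. 0 \<le> f (a\<^sup>\<star> * a))"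

text \<open>
  HOL cannot quantify over types inside a formula, so the Hilbert space ranges over the carriers
  in one fixed type of functions on the algebra.  This is no restriction: a functional that is
  represented on a Hilbert space over any type is representable in this sense, as shown by
  \<open>representableI\<close> below.
\<close>

definition representable :: "('a::star_algebra \<Rightarrow> complex) \<Rightarrow> bool"
  where "representable f \<longleftrightarrow>
    Vector_Spaces.linear scaleC (*) f \<and>
    (\<exists>(H :: ('a \<Rightarrow> complex) hspace) \<pi> \<zeta>.
      hilbert_space H \<and> star_representation H \<pi> \<and> \<zeta> \<in> hcarrier H \<and>
      (\<forall>a. f a = hinner H (\<pi> a \<zeta>) \<zeta>))"

definition gns_triple ::
    "('a::star_algebra \<Rightarrow> complex) \<Rightarrow> 'v::complex_vector hspace \<Rightarrow> ('a \<Rightarrow> 'v \<Rightarrow> 'v) \<Rightarrow> 'v \<Rightarrow> bool"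
  where "gns_triple f H \<pi> \<zeta> \<longleftrightarrow>
    hilbert_space H \<and> star_representation H \<pi> \<and> cyclic_vector H \<pi> \<zeta> \<and>
    (\<forall>a. f a = hinner H (\<pi> a \<zeta>) \<zeta>)"

definition gns_graph_closure ::
    "'v::complex_vector hspace \<Rightarrow> ('a::star_algebra \<Rightarrow> 'v \<Rightarrow> 'v) \<Rightarrow> 'v \<Rightarrow>
     'w::complex_vector hspace \<Rightarrow> ('a \<Rightarrow> 'w \<Rightarrow> 'w) \<Rightarrow> 'w \<Rightarrow> ('v \<times> 'w) set"
  where "gns_graph_closure Hf \<pi>f \<zeta>f Hg \<pi>g \<zeta>g =
    htopology (Hf \<oplus>\<^sub>H Hg) closure_of {(\<pi>f a \<zeta>f, \<pi>g a \<zeta>g) |a. True}"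

text \<open>The parallel sum of two functionals, in terms of their GNS-triples.\<close>

definition parallel_sum ::
    "'v::complex_vector hspace \<Rightarrow> ('a::star_algebra \<Rightarrow> 'v \<Rightarrow> 'v) \<Rightarrow> 'v \<Rightarrow>
     'w::complex_vector hspace \<Rightarrow> ('a \<Rightarrow> 'w \<Rightarrow> 'w) \<Rightarrow> 'w \<Rightarrow> 'a \<Rightarrow> complex"
  where "parallel_sum Hf \<pi>f \<zeta>f Hg \<pi>g \<zeta>g a =
    (let H = Hf \<oplus>\<^sub>H Hg;
         M = gns_graph_closure Hf \<pi>f \<zeta>f Hg \<pi>g \<zeta>g;
         \<xi> = orth_projection H (orth_complement H M) (\<zeta>f, 0)
     in hinner H ((\<pi>f \<oplus>\<^sub>r \<pi>g) a \<xi>) \<xi>)"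

definition dominated ::
    "('a::star_algebra \<Rightarrow> complex) \<Rightarrow> ('a \<Rightarrow> complex) \<Rightarrow> bool"  (infix \<open>\<preceq>\<close> 50)
  where "h \<preceq> f \<longleftrightarrow> (\<forall>a. h (a\<^sup>\<star> * a) \<le> f (a\<^sup>\<star> * a))"

definition mutually_singular ::
    "('a::star_algebra \<Rightarrow> complex) \<Rightarrow> ('a \<Rightarrow> complex) \<Rightarrow> bool"
  where "mutually_singular f g \<longleftrightarrow>
    (\<forall>h. representable h \<and> h \<preceq> f \<and> h \<preceq> g \<longrightarrow> (\<forall>a. h a = 0))"

text \<open>\<open>semisingular f g\<close> reads: \<open>g\<close> is \<open>f\<close>-semisingular.\<close>

definition semisingular ::
    "('a::star_algebra \<Rightarrow> complex) \<Rightarrow> ('a \<Rightarrow> complex) \<Rightarrow> bool"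
  where "semisingular f g \<longleftrightarrow>
    (\<exists>s :: nat \<Rightarrow> 'a.
      (\<lambda>n. f ((s n)\<^sup>\<star> * s n)) \<longlonglongrightarrow> 0 \<and>
      ((\<lambda>(n, m). g ((s n - s m)\<^sup>\<star> * (s n - s m))) \<longlongrightarrow> 0) (sequentially \<times>\<^sub>F sequentially) \<and>
      (\<forall>a. (\<lambda>n. g ((s n)\<^sup>\<star> * a)) \<longlonglongrightarrow> g a))"


section \<open>Independence of representability from the ambient type\<close>

context pre_hilbert_space
begin

lemma zero_mem: "0 \<in> hcarrier H"
  and add_mem: "x \<in> hcarrier H \<Longrightarrow> y \<in> hcarrier H \<Longrightarrow> x + y \<in> hcarrier H"
  and scaleC_mem: "x \<in> hcarrier H \<Longrightarrow> c *\<^sub>C x \<in> hcarrier H"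
  and diff_mem: "x \<in> hcarrier H \<Longrightarrow> y \<in> hcarrier H \<Longrightarrow> x - y \<in> hcarrier H"
  using subspace complex_vector.subspace_0 complex_vector.subspace_add
    complex_vector.subspace_scale complex_vector.subspace_diff by blast+

lemma hinner_add_right:
  assumes "x \<in> hcarrier H" "y \<in> hcarrier H" "z \<in> hcarrier H"
  shows "hinner H z (x + y) = hinner H z x + hinner H z y"
  using hinner_commute[of z "x + y"] hinner_commute[of z x] hinner_commute[of z y]
    hinner_add_left[OF assms] assms add_mem by simp

lemma hinner_scaleC_right:
  assumes "x \<in> hcarrier H" "z \<in> hcarrier H"
  shows "hinner H z (c *\<^sub>C x) = cnj c * hinner H z x"
  using hinner_commute[of z "c *\<^sub>C x"] hinner_commute[of z x]
    hinner_scaleC_left[OF assms] assms scaleC_mem by simp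

lemma hinner_diff_left:
  assumes "x \<in> hcarrier H" "y \<in> hcarrier H" "z \<in> hcarrier H"
  shows "hinner H (x - y) z = hinner H x z - hinner H y z"
  using hinner_add_left[of "x - y" y z] assms diff_mem by simp

lemma hinner_diff_right:
  assumes "x \<in> hcarrier H" "y \<in> hcarrier H" "z \<in> hcarrier H"
  shows "hinner H z (x - y) = hinner H z x - hinner H z y"
  using hinner_add_right[of "x - y" y z] assms diff_mem by simp

lemma hinner_zero_left: "x \<in> hcarrier H \<Longrightarrow> hinner H 0 x = 0"
  using hinner_diff_left[of x x x] by simp

lemma hinner_self:
  assumes "x \<in> hcarrier H"
  shows "hinner H x x = complex_of_real ((hnorm H x)\<^sup>2)" and "hnorm H x \<ge> 0"
    and "hnorm H x = 0 \<longleftrightarrow> x = 0"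
proof -
  have *: "Re (hinner H x x) \<ge> 0 \<and> Im (hinner H x x) = 0 \<and> (Re (hinner H x x) = 0 \<longleftrightarrow> x = 0)"
    using hinner_pos[OF assms] hinner_zero_left[OF zero_mem] assms
    by (cases "x = 0") (auto simp: less_complex_def)
  then show "hinner H x x = complex_of_real ((hnorm H x)\<^sup>2)" "hnorm H x \<ge> 0"
      "hnorm H x = 0 \<longleftrightarrow> x = 0"
    by (simp_all add: hnorm_def complex_eq_iff)
qed

lemma Cauchy_Schwarz:
  assumes x: "x \<in> hcarrier H" and y: "y \<in> hcarrier H"
  shows "cmod (hinner H x y) \<le> hnorm H x * hnorm H y"
proof (cases "y = 0")
  case True
  then show ?thesis
    using hinner_commute[OF x y] hinner_zero_left[OF x] hinner_self(3)[OF y] by simp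
next
  case False
  define b where "b = hnorm H y"
  define c where "c = hinner H x y"
  have b: "b > 0"
    using False hinner_self(2,3)[OF y] by (simp add: b_def less_le)
  define z where "z = x - (c / b\<^sup>2) *\<^sub>C y"
  have z: "z \<in> hcarrier H"
    by (simp add: z_def x y diff_mem scaleC_mem)
  have yy: "hinner H y y = complex_of_real (b\<^sup>2)"
    using hinner_self(1)[OF y] by (simp add: b_def)
  have yx: "hinner H y x = cnj c"
    using hinner_commute[OF y x] by (simp add: c_def)
  have "hinner H z y = 0"
    using b x y yy by (simp add: z_def hinner_diff_left hinner_scaleC_left scaleC_mem flip: c_def)
  then have "hinner H z (x - (c / b\<^sup>2) *\<^sub>C y) = hinner H z x"
    using x y z by (simp add: hinner_diff_right hinner_scaleC_right scaleC_mem)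
  then have "hinner H z z = hinner H z x"
    by (simp only: z_def[symmetric])
  also have "\<dots> = hinner H x x - (c / b\<^sup>2) * cnj c"
    using x y by (simp add: z_def hinner_diff_left hinner_scaleC_left scaleC_mem yx)
  also have "\<dots> = complex_of_real ((hnorm H x)\<^sup>2 - (cmod c)\<^sup>2 / b\<^sup>2)"
    using hinner_self(1)[OF x] complex_norm_square[of c] by simp
  finally have "(hnorm H z)\<^sup>2 = (hnorm H x)\<^sup>2 - (cmod c)\<^sup>2 / b\<^sup>2"
    using hinner_self(1)[OF z] by (metis of_real_eq_iff)
  then have "(cmod c)\<^sup>2 / b\<^sup>2 \<le> (hnorm H x)\<^sup>2"
    by (metis diff_ge_0_iff_ge zero_le_power2)
  then have "(cmod c)\<^sup>2 \<le> (hnorm H x * b)\<^sup>2"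
    using b by (simp add: field_simps power_mult_distrib)
  then show ?thesis
    using b hinner_self(2)[OF x] by (simp add: abs_le_square_iff[symmetric] b_def c_def)
qed

lemma hnorm_triangle:
  assumes x: "x \<in> hcarrier H" and y: "y \<in> hcarrier H"
  shows "hnorm H (x + y) \<le> hnorm H x + hnorm H y"
proof -
  have "complex_of_real ((hnorm H (x + y))\<^sup>2)
      = hinner H x x + hinner H y y + (hinner H x y + cnj (hinner H x y))"
    using hinner_self(1)[OF add_mem[OF x y]] hinner_commute[OF y x] x y
    by (simp add: hinner_add_left hinner_add_right add_mem add_ac)
  then have "(hnorm H (x + y))\<^sup>2 = (hnorm H x)\<^sup>2 + (hnorm H y)\<^sup>2 + 2 * Re (hinner H x y)"
    using hinner_self(1)[OF x] hinner_self(1)[OF y] by (simp add: complex_eq_iff)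
  also have "\<dots> \<le> (hnorm H x)\<^sup>2 + (hnorm H y)\<^sup>2 + 2 * (hnorm H x * hnorm H y)"
    using Cauchy_Schwarz[OF x y] complex_Re_le_cmod[of "hinner H x y"] by linarith
  also have "\<dots> = (hnorm H x + hnorm H y)\<^sup>2"
    by (simp add: power2_sum)
  finally show ?thesis
    by (rule power2_le_imp_le) (simp add: hinner_self(2) x y)
qed

lemma hnorm_minus_commute:
  assumes x: "x \<in> hcarrier H" and y: "y \<in> hcarrier H"
  shows "hnorm H (x - y) = hnorm H (y - x)"
  using x y by (simp add: hnorm_def hinner_diff_left hinner_diff_right diff_mem)

lemma Metric_space_hdist: "Metric_space (hcarrier H) (hdist H)"
proof
  show "0 \<le> hdist H x y" for x y
    by (simp add: hdist_def hinner_self diff_mem)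
  show "hdist H x y = hdist H y x" for x y
    by (simp add: hdist_def hnorm_minus_commute)
  show "hdist H x y = 0 \<longleftrightarrow> x = y" if "x \<in> hcarrier H" "y \<in> hcarrier H" for x y
    using that by (simp add: hdist_def hinner_self diff_mem)
  show "hdist H x z \<le> hdist H x y + hdist H y z"
    if "x \<in> hcarrier H" "y \<in> hcarrier H" "z \<in> hcarrier H" for x y z
    using that hnorm_triangle[of "x - y" "y - z"] by (simp add: hdist_def diff_mem)
qed

lemma mcomplete_iff:
  "Metric_space.mcomplete (hcarrier H) (hdist H) \<longleftrightarrow>
    (\<forall>s. range s \<subseteq> hcarrier H \<and>
        (\<forall>e>0. \<exists>N. \<forall>n m. N \<le> n \<longrightarrow> N \<le> m \<longrightarrow> hnorm H (s n - s m) < e) \<longrightarrow>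
      (\<exists>x\<in>hcarrier H. (\<lambda>n. hnorm H (s n - x)) \<longlonglongrightarrow> 0))"
proof -
  interpret Metric_space "hcarrier H" "hdist H"
    by (rule Metric_space_hdist)
  have lim: "limitin mtopology s x sequentially \<longleftrightarrow>
      x \<in> hcarrier H \<and> (\<lambda>n. hnorm H (s n - x)) \<longlonglongrightarrow> 0"
    if "range s \<subseteq> hcarrier H" for s x
    using that hinner_self(2) diff_mem
    by (auto simp: limit_metric_sequentially LIMSEQ_iff hdist_def range_subsetD abs_of_nonneg)
  have cau: "MCauchy s \<longleftrightarrow> range s \<subseteq> hcarrier H \<and>
      (\<forall>e>0. \<exists>N. \<forall>n m. N \<le> n \<longrightarrow> N \<le> m \<longrightarrow> hnorm H (s n - s m) < e)" for s
    by (cases "range s \<subseteq> hcarrier H") (auto simp: MCauchy_def hdist_def range_subsetD)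
  show ?thesis
  proof -
    have "(\<exists>x. limitin mtopology s x sequentially) \<longleftrightarrow>
        (\<exists>x\<in>hcarrier H. (\<lambda>n. hnorm H (s n - x)) \<longlonglongrightarrow> 0)"
      if "MCauchy s" for s
      using that lim[of s] by (auto simp: MCauchy_def)
    then have "mcomplete \<longleftrightarrow>
        (\<forall>s. MCauchy s \<longrightarrow> (\<exists>x\<in>hcarrier H. (\<lambda>n. hnorm H (s n - x)) \<longlonglongrightarrow> 0))"
      by (auto simp: mcomplete_def)
    then show ?thesis
      by (simp only: cau)
  qed
qed

end

lemma representableI:
  fixes H :: "'v::complex_vector hspace" and f :: "'a::star_algebra \<Rightarrow> complex"
  assumes hilbert: "hilbert_space H" and rep: "star_representation H \<pi>"
    and \<zeta>: "\<zeta> \<in> hcarrier H" and f: "\<And>a. f a = hinner H (\<pi> a \<zeta>) \<zeta>"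
  shows "representable f"
proof -
  interpret hilbert_space H by (rule hilbert)
  have bdd: "bounded_operator H (\<pi> a)" for a
    using rep by (simp add: star_representation_def)
  have \<pi>_mem: "\<pi> a x \<in> hcarrier H" if "x \<in> hcarrier H" for a x
    using bdd that by (simp add: bounded_operator_def)
  have \<pi>_add: "\<pi> a (x + y) = \<pi> a x + \<pi> a y"
    if "x \<in> hcarrier H" "y \<in> hcarrier H" for a x y
    using bdd that by (simp add: bounded_operator_def)
  have \<pi>_scaleC: "\<pi> a (c *\<^sub>C x) = c *\<^sub>C \<pi> a x" if "x \<in> hcarrier H" for a c x
    using bdd that by (simp add: bounded_operator_def)
  have rep_add: "\<pi> (a + b) x = \<pi> a x + \<pi> b x" if "x \<in> hcarrier H" for a b x
    using rep that by (simp add: star_representation_def)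
  have rep_scaleC: "\<pi> (c *\<^sub>C a) x = c *\<^sub>C \<pi> a x" if "x \<in> hcarrier H" for a c x
    using rep that by (simp add: star_representation_def)
  have rep_mult: "\<pi> (a * b) x = \<pi> a (\<pi> b x)" if "x \<in> hcarrier H" for a b x
    using rep that by (simp add: star_representation_def)
  have rep_star: "hinner H (\<pi> (a\<^sup>\<star>) x) y = hinner H x (\<pi> a y)"
    if "x \<in> hcarrier H" "y \<in> hcarrier H" for a x y
    using rep that by (simp add: star_representation_def)
  have rep_zero: "\<pi> 0 x = 0" if "x \<in> hcarrier H" for x
    using rep_add[OF that, of 0 0] by simp

  have "Vector_Spaces.linear scaleC (*) f"
  proof -
    have "vector_space ((*) :: complex \<Rightarrow> complex \<Rightarrow> complex)"
      by unfold_locales (simp_all add: algebra_simps)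
    then show ?thesis
      using \<zeta> by (simp add: Vector_Spaces.linear_iff f rep_add rep_scaleC \<pi>_mem hinner_add_left
          hinner_scaleC_left complex_vector.vector_space_axioms)
  qed

  define e where "e = (\<lambda>a. \<zeta> + \<pi> a \<zeta>)"
  have e: "e a \<in> hcarrier H" for a
    by (simp add: e_def add_mem \<pi>_mem \<zeta>)
  define K where "K = {x \<in> hcarrier H. \<forall>y\<in>hcarrier H. (\<forall>a. hinner H y (e a) = 0) \<longrightarrow> hinner H x y = 0}"
  define \<Phi> where "\<Phi> = (\<lambda>x a. hinner H x (e a))"
  define \<Psi> where "\<Psi> = inv_into K \<Phi>"
  have K_sub: "x \<in> hcarrier H" if "x \<in> K" for x
    using that by (simp add: K_def)
  have K_zero: "0 \<in> K"
    by (simp add: K_def zero_mem hinner_zero_left)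
  have K_add: "x + y \<in> K" if "x \<in> K" "y \<in> K" for x y
    using that by (simp add: K_def add_mem hinner_add_left)
  have K_scaleC: "c *\<^sub>C x \<in> K" if "x \<in> K" for c x
    using that by (simp add: K_def scaleC_mem hinner_scaleC_left)
  have K_diff: "x - y \<in> K" if "x \<in> K" "y \<in> K" for x y
    using that by (simp add: K_def diff_mem hinner_diff_left)
  have perp: "hinner H y \<zeta> = 0 \<and> hinner H y (\<pi> a \<zeta>) = 0"
    if "y \<in> hcarrier H" "\<forall>a. hinner H y (e a) = 0" for y a
  proof -
    have "hinner H y \<zeta> = 0"
      using that(2)[rule_format, of 0] by (simp add: e_def rep_zero \<zeta>)
    then show ?thesis
      using that(1) that(2)[rule_format, of a] by (simp add: e_def hinner_add_right \<zeta> \<pi>_mem)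
  qed
  have K_\<zeta>: "\<zeta> \<in> K"
    using perp hinner_commute[OF \<zeta>] by (simp add: K_def \<zeta>)
  have K_\<pi>: "\<pi> b x \<in> K" if "x \<in> K" for b x
  proof -
    have x: "x \<in> hcarrier H"
      using that by (rule K_sub)
    have "hinner H (\<pi> b x) y = 0"
      if y: "y \<in> hcarrier H" "\<forall>a. hinner H y (e a) = 0" for y
    proof -
      have "hinner H (\<pi> (b\<^sup>\<star>) y) (e a) = hinner H y (\<pi> b \<zeta>) + hinner H y (\<pi> (b * a) \<zeta>)" for a
        using y(1) \<zeta> e by (simp add: rep_star)
          (simp add: e_def \<pi>_add \<pi>_mem rep_mult hinner_add_right)
      then have "hinner H x (\<pi> (b\<^sup>\<star>) y) = 0"
        using perp[OF y] \<open>x \<in> K\<close> y(1) by (simp add: K_def \<pi>_mem)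
      then show ?thesis
        using rep_star[OF y(1) x, of b] hinner_commute[OF \<pi>_mem[OF x] y(1), of b]
          hinner_commute[OF \<pi>_mem[OF y(1)] x, of "b\<^sup>\<star>"] by simp
    qed
    then show ?thesis
      by (simp add: K_def \<pi>_mem x)
  qed

  have \<Phi>_add: "\<Phi> (x + y) = \<Phi> x + \<Phi> y" if "x \<in> K" "y \<in> K" for x y
    using that by (simp add: \<Phi>_def fun_eq_iff hinner_add_left K_sub e)
  have \<Phi>_diff: "\<Phi> (x - y) = \<Phi> x - \<Phi> y" if "x \<in> K" "y \<in> K" for x y
    using that by (simp add: \<Phi>_def fun_eq_iff hinner_diff_left K_sub e)
  have \<Phi>_scaleC: "\<Phi> (c *\<^sub>C x) = c *\<^sub>C \<Phi> x" if "x \<in> K" for c x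
    using that by (simp add: \<Phi>_def fun_eq_iff scaleC_fun_def scaleC_complex_def
        hinner_scaleC_left K_sub e)
  have \<Phi>_zero: "\<Phi> 0 = 0"
    using \<Phi>_diff[OF K_zero K_zero] by simp
  have \<Phi>_inj: "inj_on \<Phi> K"
  proof (rule inj_onI)
    fix x y assume xy: "x \<in> K" "y \<in> K" "\<Phi> x = \<Phi> y"
    have "\<Phi> (x - y) = 0"
      using xy by (simp add: \<Phi>_diff)
    then have "\<forall>a. hinner H (x - y) (e a) = 0"
      by (simp add: \<Phi>_def fun_eq_iff)
    then have "hinner H (x - y) (x - y) = 0"
      using K_diff[OF xy(1,2)] by (simp add: K_def)
    then show "x = y"
      using hinner_self[OF K_sub[OF K_diff[OF xy(1,2)]]] by simp
  qed
  have \<Psi>\<Phi>: "\<Psi> (\<Phi> x) = x" if "x \<in> K" for x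
    using that \<Phi>_inj by (simp add: \<Psi>_def)

  define H' where "H' = \<lparr>hcarrier = \<Phi> ` K, hinner = (\<lambda>u v. hinner H (\<Psi> u) (\<Psi> v))\<rparr>"
  define \<pi>' where "\<pi>' = (\<lambda>a u. \<Phi> (\<pi> a (\<Psi> u)))"
  have carrier': "hcarrier H' = \<Phi> ` K"
    by (simp add: H'_def)
  have inner': "hinner H' (\<Phi> x) (\<Phi> y) = hinner H x y" if "x \<in> K" "y \<in> K" for x y
    using that by (simp add: H'_def \<Psi>\<Phi>)
  have norm': "hnorm H' (\<Phi> x) = hnorm H x" if "x \<in> K" for x
    using that by (simp add: hnorm_def inner')
  have \<pi>': "\<pi>' a (\<Phi> x) = \<Phi> (\<pi> a x)" if "x \<in> K" for a x
    using that by (simp add: \<pi>'_def \<Psi>\<Phi>)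

  have pre: "pre_hilbert_space H'"
  proof
    show "complex_vector.subspace (hcarrier H')"
      unfolding carrier'
    proof (rule complex_vector.subspaceI)
      show "0 \<in> \<Phi> ` K"
        using K_zero \<Phi>_zero by (metis imageI)
      show "u + v \<in> \<Phi> ` K" if "u \<in> \<Phi> ` K" "v \<in> \<Phi> ` K" for u v
        using that by (auto simp flip: \<Phi>_add intro: K_add)
      show "c *\<^sub>C u \<in> \<Phi> ` K" if "u \<in> \<Phi> ` K" for c u
        using that by (auto simp flip: \<Phi>_scaleC intro: K_scaleC)
    qed
    show "hinner H' (u + v) w = hinner H' u w + hinner H' v w"
      if "u \<in> hcarrier H'" "v \<in> hcarrier H'" "w \<in> hcarrier H'" for u v w
      using that
      by (auto simp: carrier' inner' K_add K_sub hinner_add_left simp flip: \<Phi>_add)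
    show "hinner H' (c *\<^sub>C u) v = c * hinner H' u v"
      if "u \<in> hcarrier H'" "v \<in> hcarrier H'" for u v c
      using that
      by (auto simp: carrier' inner' K_scaleC K_sub hinner_scaleC_left simp flip: \<Phi>_scaleC)
    show "hinner H' u v = cnj (hinner H' v u)"
      if uv: "u \<in> hcarrier H'" "v \<in> hcarrier H'" for u v
    proof -
      obtain x y where "x \<in> K" "y \<in> K" "u = \<Phi> x" "v = \<Phi> y"
        using uv by (auto simp: carrier')
      then show ?thesis
        using hinner_commute[of x y] by (simp only: inner' K_sub)
    qed
    show "0 < hinner H' u u" if u: "u \<in> hcarrier H'" "u \<noteq> 0" for u
    proof -
      obtain x where "x \<in> K" "u = \<Phi> x"
        using u(1) by (auto simp: carrier')
      then show ?thesis
        using hinner_pos[of x] u(2) \<Phi>_zero K_sub inner' by metis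
    qed
  qed
  interpret H': pre_hilbert_space H' by (rule pre)

  have "hilbert_space H'"
  proof (unfold_locales, unfold H'.mcomplete_iff, intro allI impI, elim conjE)
    fix s :: "nat \<Rightarrow> 'a \<Rightarrow> complex"
    assume s: "range s \<subseteq> hcarrier H'"
      and cauchy: "\<forall>e>0. \<exists>N. \<forall>n m. N \<le> n \<longrightarrow> N \<le> m \<longrightarrow> hnorm H' (s n - s m) < e"
    have "\<forall>n. \<exists>x\<in>K. s n = \<Phi> x"
      using s by (auto simp: carrier' image_iff dest: range_subsetD)
    then obtain t where t: "\<And>n. t n \<in> K" "\<And>n. s n = \<Phi> (t n)"
      by metis
    have norm_st: "hnorm H' (s n - \<Phi> x) = hnorm H (t n - x)" if "x \<in> K" for n x
      using that t by (simp add: norm' K_diff flip: \<Phi>_diff)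
    have "\<forall>e>0. \<exists>N. \<forall>n m. N \<le> n \<longrightarrow> N \<le> m \<longrightarrow> hnorm H (t n - t m) < e"
      using cauchy norm_st[OF t(1)] t(2) by simp
    moreover have "range t \<subseteq> hcarrier H"
      using t(1) K_sub by auto
    ultimately obtain l where l: "l \<in> hcarrier H" "(\<lambda>n. hnorm H (t n - l)) \<longlonglongrightarrow> 0"
      using complete unfolding mcomplete_iff by blast
    have "hinner H l y = 0" if y: "y \<in> hcarrier H" "\<forall>a. hinner H y (e a) = 0" for y
    proof -
      have "cmod (hinner H l y) \<le> hnorm H (t n - l) * hnorm H y" for n
      proof -
        have "hinner H (t n) y = 0"
          using t(1)[of n] y by (simp add: K_def)
        then have "hinner H (t n - l) y = - hinner H l y"
          using l(1) y(1) K_sub[OF t(1)] by (simp add: hinner_diff_left)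
        then show ?thesis
          using Cauchy_Schwarz[OF diff_mem[OF K_sub[OF t(1)] l(1)] y(1), of n] by simp
      qed
      moreover have "(\<lambda>n. hnorm H (t n - l) * hnorm H y) \<longlonglongrightarrow> 0"
        using tendsto_mult_left_zero[OF l(2)] by simp
      ultimately have "cmod (hinner H l y) \<le> 0"
        by (intro LIMSEQ_le_const) auto
      then show ?thesis
        by simp
    qed
    then have "l \<in> K"
      using l(1) by (simp add: K_def)
    then show "\<exists>u\<in>hcarrier H'. (\<lambda>n. hnorm H' (s n - u)) \<longlonglongrightarrow> 0"
      using l(2) norm_st by (auto simp: carrier')
  qed
  moreover have "star_representation H' \<pi>'"
  proof -
    have "bounded_operator H' (\<pi>' a)" for a
    proof -
      obtain C where "\<forall>x\<in>hcarrier H. hnorm H (\<pi> a x) \<le> C * hnorm H x"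
        using bdd[of a] by (auto simp: bounded_operator_def)
      then have "\<forall>u\<in>hcarrier H'. hnorm H' (\<pi>' a u) \<le> C * hnorm H' u"
        by (simp add: carrier' \<pi>' norm' K_\<pi> K_sub)
      moreover have "\<pi>' a (u + v) = \<pi>' a u + \<pi>' a v"
        if uv: "u \<in> hcarrier H'" "v \<in> hcarrier H'" for u v
      proof -
        obtain x y where "x \<in> K" "y \<in> K" "u = \<Phi> x" "v = \<Phi> y"
          using uv by (auto simp: carrier')
        then show ?thesis
          using \<pi>'[OF K_add, of x y a] by (simp add: \<Phi>_add \<pi>' \<pi>_add K_sub K_\<pi>)
      qed
      moreover have "\<pi>' a (c *\<^sub>C u) = c *\<^sub>C \<pi>' a u" if u: "u \<in> hcarrier H'" for c u
      proof -
        obtain x where "x \<in> K" "u = \<Phi> x"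
          using u by (auto simp: carrier')
        then show ?thesis
          using \<pi>'[OF K_scaleC, of x a c] by (simp add: \<Phi>_scaleC \<pi>' \<pi>_scaleC K_sub K_\<pi>)
      qed
      ultimately show ?thesis
        by (auto simp: bounded_operator_def carrier' \<pi>' K_\<pi>)
    qed
    then show ?thesis
      by (auto simp: star_representation_def carrier' \<pi>' rep_add rep_scaleC rep_mult rep_star
          inner' K_sub K_\<pi> simp flip: \<Phi>_add \<Phi>_scaleC)
  qed
  moreover have "\<Phi> \<zeta> \<in> hcarrier H'" "\<forall>a. f a = hinner H' (\<pi>' a (\<Phi> \<zeta>)) (\<Phi> \<zeta>)"
    by (simp_all add: carrier' K_\<zeta> f \<pi>' inner' K_\<pi>)
  ultimately show ?thesis
    using \<open>Vector_Spaces.linear scaleC (*) f\<close> unfolding representable_def by blast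
qed

end

theory Submission
  imports Defs
begin

text \<open>
  The parallel sum is the vector functional of \<open>\<xi>\<close>, the projection of \<open>\<zeta>\<^sub>f \<oplus> 0\<close> onto the
  orthogonal complement of \<open>M\<close>, under the nondegenerate representation \<open>\<pi>\<^sub>f \<oplus> \<pi>\<^sub>g\<close>, so it
  vanishes iff \<open>\<xi> = 0\<close>, i.e. iff \<open>\<zeta>\<^sub>f \<oplus> 0 \<in> M\<close>.  Since \<open>M\<close> is invariant, nondegeneracy also gives
  \<open>\<zeta>\<^sub>f \<oplus> \<zeta>\<^sub>g \<in> M\<close> without a unit; hence (ii) and (iii) are equivalent, and by invariance and
  cyclicity they force \<open>M\<close> to be everything.  As \<open>\<xi>\<close> differs from both \<open>\<zeta>\<^sub>f \<oplus> 0\<close> and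
  \<open>0 \<oplus> (- \<zeta>\<^sub>g)\<close> by elements of \<open>M\<close>, the parallel sum lies below \<open>f\<close> and \<open>g\<close>, which settles one
  direction of (vi).  Conversely, approximating \<open>0 \<oplus> \<pi>\<^sub>g(x)\<zeta>\<^sub>g\<close> in \<open>M\<close> shows that any functional
  below both is zero.  Semisingularity spells out \<open>0 \<oplus> \<zeta>\<^sub>g \<in> M\<close>: the Cauchy condition yields a
  limit, which the weak condition identifies as \<open>\<zeta>\<^sub>g\<close>.
\<close>

section \<open>Geometry of Hilbert spaces\<close>

context pre_hilbert_space
begin

section \<open>Norm identities in inner product spaces\<close>

lemma hinner_zero_right: "x \<in> hcarrier H \<Longrightarrow> hinner H x 0 = 0"
  using hinner_commute[OF _ zero_mem] hinner_zero_left by simp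

lemma minus_mem: "x \<in> hcarrier H \<Longrightarrow> - x \<in> hcarrier H"
  using diff_mem[OF zero_mem] by simp

lemma hnorm_zero: "hnorm H 0 = 0"
  using hinner_self(3) zero_mem by simp

lemma hnorm_minus: "x \<in> hcarrier H \<Longrightarrow> hnorm H (- x) = hnorm H x"
  using hnorm_minus_commute[of 0 x] zero_mem by simp

lemma hnorm_square: "x \<in> hcarrier H \<Longrightarrow> (hnorm H x)\<^sup>2 = Re (hinner H x x)"
  using hinner_self(1) by simp

lemma hnorm_diff_triangle:
  assumes "x \<in> hcarrier H" "y \<in> hcarrier H" "z \<in> hcarrier H"
  shows "hnorm H (x - z) \<le> hnorm H (x - y) + hnorm H (z - y)"
  using hnorm_triangle[of "x - y" "y - z"] hnorm_minus_commute[of y z] assms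
  by (simp add: diff_mem)

lemma pythagoras:
  assumes "x \<in> hcarrier H" "y \<in> hcarrier H" "hinner H x y = 0"
  shows "(hnorm H (x + y))\<^sup>2 = (hnorm H x)\<^sup>2 + (hnorm H y)\<^sup>2"
proof -
  have "hinner H y x = 0"
    using hinner_commute[of y x] assms by simp
  then show ?thesis
    using assms by (simp add: hnorm_square add_mem hinner_add_left hinner_add_right)
qed

lemma parallelogram:
  assumes "x \<in> hcarrier H" "y \<in> hcarrier H"
  shows "(hnorm H (x + y))\<^sup>2 + (hnorm H (x - y))\<^sup>2 = 2 * (hnorm H x)\<^sup>2 + 2 * (hnorm H y)\<^sup>2"
  using assms
  by (simp add: hnorm_square add_mem diff_mem hinner_add_left hinner_add_right
      hinner_diff_left hinner_diff_right)

lemma hnorm_scaleC: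
  assumes "x \<in> hcarrier H"
  shows "hnorm H (c *\<^sub>C x) = cmod c * hnorm H x"
proof -
  have "hinner H (c *\<^sub>C x) (c *\<^sub>C x) = complex_of_real ((cmod c * hnorm H x)\<^sup>2)"
    using assms hinner_self(1)[OF assms] complex_norm_square[of c]
    by (simp add: hinner_scaleC_left hinner_scaleC_right scaleC_mem power_mult_distrib mult.assoc)
  then show ?thesis
    using hinner_self(2)[OF assms] by (simp add: hnorm_def real_sqrt_unique)
qed

section \<open>Closures in the norm topology and limits of sequences\<close>

lemma closure_of_iff:
  assumes "S \<subseteq> hcarrier H"
  shows "x \<in> htopology H closure_of S \<longleftrightarrow>
    x \<in> hcarrier H \<and> (\<forall>e>0. \<exists>y\<in>S. hnorm H (y - x) < e)"
proof -
  interpret Metric_space "hcarrier H" "hdist H"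
    by (rule Metric_space_hdist)
  have "y \<in> mball x e \<longleftrightarrow> hnorm H (y - x) < e" if "x \<in> hcarrier H" "y \<in> S" for y e
    using that assms hnorm_minus_commute[of x y] by (auto simp: hdist_def)
  then show ?thesis
    by (auto simp: metric_closure_of)
qed

lemma closure_of_iff_sequence:
  assumes "S \<subseteq> hcarrier H"
  shows "x \<in> htopology H closure_of S \<longleftrightarrow>
    x \<in> hcarrier H \<and> (\<exists>s. (\<forall>n. s n \<in> S) \<and> (\<lambda>n. hnorm H (s n - x)) \<longlonglongrightarrow> 0)"
proof (intro iffI; (elim conjE exE)?)
  assume x: "x \<in> htopology H closure_of S"
  then have "\<forall>n. \<exists>y\<in>S. hnorm H (y - x) < 1 / real (Suc n)" and xH: "x \<in> hcarrier H"
    using closure_of_iff[OF assms] by auto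
  then obtain s where s: "\<And>n. s n \<in> S" "\<And>n. hnorm H (s n - x) < 1 / real (Suc n)"
    by metis
  have "(\<lambda>n. hnorm H (s n - x)) \<longlonglongrightarrow> 0"
  proof (rule tendsto_sandwich[OF _ _ tendsto_const LIMSEQ_Suc[OF lim_1_over_n]])
    show "\<forall>\<^sub>F n in sequentially. 0 \<le> hnorm H (s n - x)"
      using s(1) assms xH by (auto intro!: always_eventually hinner_self(2) diff_mem)
    show "\<forall>\<^sub>F n in sequentially. hnorm H (s n - x) \<le> 1 / of_nat (Suc n)"
      using s(2) by (auto intro!: always_eventually less_imp_le)
  qed
  then show "x \<in> hcarrier H \<and> (\<exists>s. (\<forall>n. s n \<in> S) \<and> (\<lambda>n. hnorm H (s n - x)) \<longlonglongrightarrow> 0)"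
    using s(1) xH by blast
next
  fix s assume x: "x \<in> hcarrier H" and s: "\<forall>n. s n \<in> S" "(\<lambda>n. hnorm H (s n - x)) \<longlonglongrightarrow> 0"
  have "\<exists>y\<in>S. hnorm H (y - x) < e" if "e > 0" for e
  proof -
    have "\<forall>\<^sub>F n in sequentially. hnorm H (s n - x) < e"
      using order_tendstoD(2)[OF s(2) that] .
    then show ?thesis
      using s(1) eventually_happens'[OF sequentially_bot] by blast
  qed
  then show "x \<in> htopology H closure_of S"
    using closure_of_iff[OF assms] x by simp
qed

lemma hnorm_add_diff_tendsto_0:
  assumes "\<And>n. s n \<in> hcarrier H" "\<And>n. t n \<in> hcarrier H" "x \<in> hcarrier H" "y \<in> hcarrier H"
    and "(\<lambda>n. hnorm H (s n - x)) \<longlonglongrightarrow> 0" "(\<lambda>n. hnorm H (t n - y)) \<longlonglongrightarrow> 0"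
  shows "(\<lambda>n. hnorm H (s n + t n - (x + y))) \<longlonglongrightarrow> 0"
proof (rule tendsto_sandwich[OF _ _ tendsto_const])
  show "(\<lambda>n. hnorm H (s n - x) + hnorm H (t n - y)) \<longlonglongrightarrow> 0"
    using tendsto_add[OF assms(5,6)] by simp
  show "\<forall>\<^sub>F n in sequentially. 0 \<le> hnorm H (s n + t n - (x + y))"
    using assms(1-4) by (simp add: hinner_self(2) add_mem diff_mem)
  show "\<forall>\<^sub>F n in sequentially.
      hnorm H (s n + t n - (x + y)) \<le> hnorm H (s n - x) + hnorm H (t n - y)"
    using assms(1-4) hnorm_triangle[of "s _ - x" "t _ - y"]
    by (simp add: diff_mem add_diff_add)
qed

text \<open>Cauchy-Schwarz makes the inner product continuous. This carries orthogonality over to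
  closures and turns norm limits into the weak limits of semisingularity.\<close>

lemma hinner_tendsto:
  assumes "\<And>n. s n \<in> hcarrier H" "x \<in> hcarrier H" "y \<in> hcarrier H"
    and "(\<lambda>n. hnorm H (s n - x)) \<longlonglongrightarrow> 0"
  shows "(\<lambda>n. hinner H y (s n)) \<longlonglongrightarrow> hinner H y x"
proof -
  have "(\<lambda>n. hinner H y (s n) - hinner H y x) \<longlonglongrightarrow> 0"
  proof (rule Lim_null_comparison)
    show "\<forall>\<^sub>F n in sequentially.
        norm (hinner H y (s n) - hinner H y x) \<le> hnorm H y * hnorm H (s n - x)"
      using assms(1-3) Cauchy_Schwarz[of y "s _ - x"]
      by (simp add: diff_mem hinner_diff_right)
    show "(\<lambda>n. hnorm H y * hnorm H (s n - x)) \<longlonglongrightarrow> 0"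
      using tendsto_mult_right_zero[OF assms(4)] .
  qed
  then show ?thesis
    by (simp add: LIM_zero_iff)
qed

lemma closure_of_subspace:
  assumes S: "complex_vector.subspace S" "S \<subseteq> hcarrier H"
  shows "complex_vector.subspace (htopology H closure_of S)"
proof (rule complex_vector.subspaceI)
  note closure = closure_of_iff_sequence[OF S(2)]
  show "0 \<in> htopology H closure_of S"
    unfolding closure using zero_mem complex_vector.subspace_0[OF S(1)]
    by (intro conjI exI[of _ "\<lambda>n. 0"]) (simp_all add: hnorm_zero)
  show "x + y \<in> htopology H closure_of S"
    if xy: "x \<in> htopology H closure_of S" "y \<in> htopology H closure_of S" for x y
  proof -
    obtain s t where st: "\<And>n. s n \<in> S" "\<And>n. t n \<in> S"
        "(\<lambda>n. hnorm H (s n - x)) \<longlonglongrightarrow> 0" "(\<lambda>n. hnorm H (t n - y)) \<longlonglongrightarrow> 0"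
        and xyH: "x \<in> hcarrier H" "y \<in> hcarrier H"
      using xy unfolding closure by blast
    have "(\<lambda>n. hnorm H (s n + t n - (x + y))) \<longlonglongrightarrow> 0"
      using st xyH S(2) by (intro hnorm_add_diff_tendsto_0) auto
    then show ?thesis
      unfolding closure using st(1,2) xyH complex_vector.subspace_add[OF S(1)] add_mem
      by (intro conjI exI[of _ "\<lambda>n. s n + t n"]) auto
  qed
  show "c *\<^sub>C x \<in> htopology H closure_of S" if x: "x \<in> htopology H closure_of S" for c x
  proof -
    obtain s where s: "\<And>n. s n \<in> S" "(\<lambda>n. hnorm H (s n - x)) \<longlonglongrightarrow> 0" and xH: "x \<in> hcarrier H"
      using x unfolding closure by blast
    have "hnorm H (c *\<^sub>C s n - c *\<^sub>C x) = cmod c * hnorm H (s n - x)" for n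
      using s(1)[of n] xH S(2) hnorm_scaleC[of "s n - x" c] diff_mem
      by (auto simp: complex_vector.scale_right_diff_distrib)
    then have "(\<lambda>n. hnorm H (c *\<^sub>C s n - c *\<^sub>C x)) \<longlonglongrightarrow> 0"
      using tendsto_mult_right_zero[OF s(2)] by simp
    then show ?thesis
      unfolding closure using s(1) xH complex_vector.subspace_scale[OF S(1)] scaleC_mem
      by (intro conjI exI[of _ "\<lambda>n. c *\<^sub>C s n"]) auto
  qed
qed

lemma closure_of_mem:
  assumes "x \<in> htopology H closure_of S"
  shows "x \<in> hcarrier H"
proof -
  interpret Metric_space "hcarrier H" "hdist H"
    by (rule Metric_space_hdist)
  show ?thesis
    using assms by (simp add: metric_closure_of)
qed

lemma closure_of_superset: "S \<subseteq> hcarrier H \<Longrightarrow> S \<subseteq> htopology H closure_of S"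
  by (simp add: closure_of_subset Metric_space.topspace_mtopology[OF Metric_space_hdist])

section \<open>Orthogonal complements and uniqueness of projections\<close>

lemma orth_complementD:
  assumes "x \<in> orth_complement H S"
  shows "x \<in> hcarrier H" and "y \<in> S \<Longrightarrow> hinner H x y = 0"
  using assms by (auto simp: orth_complement_def)

text \<open>By continuity of the inner product, orthogonality to a cyclic subspace need only be
  checked on the orbit.\<close>

lemma orth_complement_closure_of:
  assumes "S \<subseteq> hcarrier H"
  shows "orth_complement H (htopology H closure_of S) = orth_complement H S"
proof
  show "orth_complement H (htopology H closure_of S) \<subseteq> orth_complement H S"
    using closure_of_superset[OF assms] by (auto simp: orth_complement_def)
  have "hinner H x y = 0"
    if x: "x \<in> orth_complement H S" and y: "y \<in> htopology H closure_of S" for x y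
  proof -
    obtain s where s: "\<And>n. s n \<in> S" "(\<lambda>n. hnorm H (s n - y)) \<longlonglongrightarrow> 0" and yH: "y \<in> hcarrier H"
      using y unfolding closure_of_iff_sequence[OF assms] by blast
    have "(\<lambda>n. hinner H x (s n)) \<longlonglongrightarrow> hinner H x y"
      using s yH assms orth_complementD(1)[OF x] by (intro hinner_tendsto) auto
    then show ?thesis
      using orth_complementD(2)[OF x s(1)] by (simp add: LIMSEQ_const_iff)
  qed
  then show "orth_complement H S \<subseteq> orth_complement H (htopology H closure_of S)"
    by (auto simp: orth_complement_def)
qed

lemma orth_complement_Int:
  assumes "x \<in> S" "x \<in> orth_complement H S"
  shows "x = 0"
  using assms hinner_self(1,3)[of x] by (auto simp: orth_complement_def)

lemma subspace_orth_complement: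
  assumes "S \<subseteq> hcarrier H"
  shows "complex_vector.subspace (orth_complement H S)"
  using assms
  by (auto intro!: complex_vector.subspaceI
      simp: orth_complement_def zero_mem add_mem scaleC_mem hinner_zero_left hinner_add_left
        hinner_scaleC_left subset_iff)

text \<open>Two candidates for the definite description differ by a vector that lies both in
  \<open>S\<close> and in its complement, hence by \<open>0\<close>. Existence is a separate matter
  and needs completeness.\<close>

lemma orth_projection_eqI:
  assumes S: "complex_vector.subspace S" "S \<subseteq> hcarrier H"
    and p: "p \<in> S" "x - p \<in> orth_complement H S"
  shows "orth_projection H S x = p"
  unfolding orth_projection_def
proof (rule the_equality)
  fix q assume q: "q \<in> S \<and> x - q \<in> orth_complement H S"
  have "q - p = x - p - (x - q)"
    by simp
  then have "q - p \<in> orth_complement H S"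
    using complex_vector.subspace_diff[OF subspace_orth_complement[OF S(2)] p(2), of "x - q"] q
    by simp
  then show "q = p"
    using orth_complement_Int[of "q - p" S] complex_vector.subspace_diff[OF S(1)] q p(1) by auto
qed (use p in simp)

text \<open>Splitting off the component of \<open>z\<close> along \<open>y\<close> leaves a vector
  \<open>w\<close> orthogonal to \<open>y\<close>. By Pythagoras \<open>w\<close> is strictly
  shorter than \<open>z\<close> unless the coefficient \<open>c\<close> is zero, and minimality
  excludes a shorter vector.\<close>

lemma minimal_imp_orthogonal:
  assumes z: "z \<in> hcarrier H" and y: "y \<in> hcarrier H"
    and min: "\<And>c. hnorm H z \<le> hnorm H (z - c *\<^sub>C y)"
  shows "hinner H z y = 0"
proof (cases "y = 0")
  case True
  then show ?thesis
    using hinner_zero_right z by simp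
next
  case False
  define b where "b = hnorm H y"
  have b: "b > 0"
    using False hinner_self(2,3)[OF y] by (simp add: b_def less_le)
  define c where "c = hinner H z y / b\<^sup>2"
  have c: "c * complex_of_real (b\<^sup>2) = hinner H z y"
    using b by (simp add: c_def)
  define w where "w = z - c *\<^sub>C y"
  have w: "w \<in> hcarrier H"
    by (simp add: w_def z y diff_mem scaleC_mem)
  have "hinner H w y = 0"
    using z y c hinner_self(1)[OF y]
    by (simp add: w_def hinner_diff_left hinner_scaleC_left scaleC_mem b_def)
  then have "(hnorm H (w + c *\<^sub>C y))\<^sup>2 = (hnorm H w)\<^sup>2 + (hnorm H (c *\<^sub>C y))\<^sup>2"
    using w y by (intro pythagoras) (simp_all add: scaleC_mem hinner_scaleC_right)
  moreover have "(hnorm H z)\<^sup>2 \<le> (hnorm H w)\<^sup>2"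
    using min[of c] hinner_self(2)[OF z] by (simp add: w_def power_mono)
  ultimately have "(cmod c * b)\<^sup>2 \<le> 0"
    by (simp add: w_def hnorm_scaleC y b_def)
  then have "c = 0"
    using b by simp
  then show ?thesis
    using c by simp
qed

end

section \<open>The projection theorem\<close>

context hilbert_space
begin

text \<open>A minimising sequence is Cauchy by the parallelogram law. Completeness supplies its
  limit, and closedness keeps the limit in \<open>S\<close>.\<close>

lemma ex_minimal_distance:
  assumes S: "complex_vector.subspace S" "S \<subseteq> hcarrier H"
    and closed: "htopology H closure_of S \<subseteq> S" and x: "x \<in> hcarrier H"
  shows "\<exists>p\<in>S. \<forall>y\<in>S. hnorm H (x - p) \<le> hnorm H (x - y)"
proof -
  define d where "d = (INF y\<in>S. hnorm H (x - y))"
  have bdd: "bdd_below ((\<lambda>y. hnorm H (x - y)) ` S)"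
    using S(2) x hinner_self(2) diff_mem by (intro bdd_belowI2[of _ 0]) auto
  have ne: "S \<noteq> {}"
    using complex_vector.subspace_0[OF S(1)] by auto
  have d_le: "d \<le> hnorm H (x - y)" if "y \<in> S" for y
    unfolding d_def using bdd that by (rule cINF_lower)
  have d_nonneg: "0 \<le> d"
    unfolding d_def using ne S(2) x hinner_self(2) diff_mem by (intro cINF_greatest) auto
  \<comment> \<open>The slack is put on the squared distance, so that it enters the parallelogram
    law linearly.\<close>
  have "\<exists>y\<in>S. (hnorm H (x - y))\<^sup>2 < d\<^sup>2 + e" if "e > 0" for e
  proof -
    have "d < sqrt (d\<^sup>2 + e)"
      using that d_nonneg by (intro real_less_rsqrt) simp
    then obtain y where y: "y \<in> S" "hnorm H (x - y) < sqrt (d\<^sup>2 + e)"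
      unfolding d_def using cINF_less_iff[OF ne bdd] by auto
    then have "(hnorm H (x - y))\<^sup>2 < (sqrt (d\<^sup>2 + e))\<^sup>2"
      using S(2) x hinner_self(2) diff_mem by (intro power_strict_mono) auto
    then show ?thesis
      using y(1) that by auto
  qed
  then have "\<forall>n. \<exists>y\<in>S. (hnorm H (x - y))\<^sup>2 < d\<^sup>2 + 1 / real (Suc n)"
    by simp
  then obtain s where s: "\<And>n. s n \<in> S" "\<And>n. (hnorm H (x - s n))\<^sup>2 < d\<^sup>2 + 1 / real (Suc n)"
    by metis
  have sH: "s n \<in> hcarrier H" for n
    using s(1) S(2) by auto
  have cauchy: "(hnorm H (s n - s m))\<^sup>2 \<le> 2 / real (Suc n) + 2 / real (Suc m)" for n m
  proof -
    \<comment> \<open>\<open>c\<close> is the midpoint of \<open>s n\<close> and \<open>s m\<close>.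
      It lies in \<open>S\<close>, so the sum term in the parallelogram law is at least
      \<open>4 * d\<^sup>2\<close>, which cancels the \<open>d\<^sup>2\<close> terms on the other
      side.\<close>
    define c where "c = (1/2 :: complex) *\<^sub>C (s n + s m)"
    have c: "c \<in> S"
      using s(1) S(1) by (simp add: c_def complex_vector.subspace_add complex_vector.subspace_scale)
    have cH: "c \<in> hcarrier H"
      using c S(2) by auto
    have "(2 :: complex) *\<^sub>C (x - c) = (1 + 1 :: complex) *\<^sub>C x - (s n + s m)"
      by (simp add: c_def complex_vector.scale_right_diff_distrib)
    also have "\<dots> = (x - s n) + (x - s m)"
      by (simp only: complex_vector.scale_left_distrib complex_vector.scale_one) simp
    finally have "hnorm H ((x - s n) + (x - s m)) = 2 * hnorm H (x - c)"
      using hnorm_scaleC[of "x - c" 2] x cH by (simp add: diff_mem)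
    moreover have "(hnorm H ((x - s n) + (x - s m)))\<^sup>2 + (hnorm H ((x - s n) - (x - s m)))\<^sup>2
        = 2 * (hnorm H (x - s n))\<^sup>2 + 2 * (hnorm H (x - s m))\<^sup>2"
      using x sH by (intro parallelogram) (simp_all add: diff_mem)
    moreover have "hnorm H ((x - s n) - (x - s m)) = hnorm H (s n - s m)"
      using hnorm_minus_commute[OF sH sH, of n m] by simp
    moreover have "d\<^sup>2 \<le> (hnorm H (x - c))\<^sup>2"
      using d_le[OF c] d_nonneg by (simp add: power_mono)
    ultimately show ?thesis
      using s(2)[of n] s(2)[of m] by (simp add: power_mult_distrib)
  qed
  have "\<exists>N. \<forall>n m. N \<le> n \<longrightarrow> N \<le> m \<longrightarrow> hnorm H (s n - s m) < e" if e: "e > 0" for e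
  proof -
    \<comment> \<open>For indices from \<open>N\<close> on, the bound in \<open>cauchy\<close> is at
      most \<open>4 / real (Suc N)\<close>, which this choice puts below
      \<open>e\<^sup>2\<close>.\<close>
    obtain N where N: "4 / e\<^sup>2 < real (Suc N)"
      using reals_Archimedean2[of "4 / e\<^sup>2"] by (metis less_trans lessI of_nat_less_iff)
    have "hnorm H (s n - s m) < e" if nm: "N \<le> n" "N \<le> m" for n m
    proof -
      have "2 / real (Suc n) + 2 / real (Suc m) \<le> 2 / real (Suc N) + 2 / real (Suc N)"
        using nm by (intro add_mono divide_left_mono) auto
      also have "\<dots> = 4 / real (Suc N)"
        by (simp flip: add_divide_distrib)
      also have "\<dots> < e\<^sup>2"
        using N e by (simp add: field_simps del: of_nat_Suc)
      finally have "(hnorm H (s n - s m))\<^sup>2 < e\<^sup>2"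
        using cauchy[of n m] by simp
      then show ?thesis
        using e by (simp add: power_less_imp_less_base)
    qed
    then show ?thesis
      by blast
  qed
  then obtain p where p: "p \<in> hcarrier H" "(\<lambda>n. hnorm H (s n - p)) \<longlonglongrightarrow> 0"
    using complete sH unfolding mcomplete_iff by (metis image_subsetI)
  have pS: "p \<in> S"
    using closed p s(1) closure_of_iff_sequence[OF S(2)] by blast
  have "hnorm H (x - p) \<le> d"
  proof (rule LIMSEQ_le_const)
    show "(\<lambda>n. sqrt (d\<^sup>2 + 1 / real (Suc n)) + hnorm H (s n - p)) \<longlonglongrightarrow> d"
      using tendsto_add[OF tendsto_real_sqrt[OF tendsto_add[OF tendsto_const[of "d\<^sup>2"]
            LIMSEQ_Suc[OF lim_1_over_n]]] p(2)] d_nonneg by simp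
    have "hnorm H (x - p) \<le> sqrt (d\<^sup>2 + 1 / real (Suc n)) + hnorm H (s n - p)" for n
    proof -
      have "hnorm H (x - s n) \<le> sqrt (d\<^sup>2 + 1 / real (Suc n))"
        using s(2)[of n] by (intro real_le_rsqrt) simp
      then show ?thesis
        using hnorm_diff_triangle[OF x sH p(1), of n] hnorm_minus_commute[OF p(1) sH, of n]
        by simp
    qed
    then show "\<exists>N. \<forall>n\<ge>N. hnorm H (x - p) \<le> sqrt (d\<^sup>2 + 1 / real (Suc n)) + hnorm H (s n - p)"
      by blast
  qed
  then show ?thesis
    using pS d_le by force
qed

text \<open>Moving a nearest point \<open>p\<close> by a multiple of any \<open>y\<close> in
  \<open>S\<close> stays in \<open>S\<close>, so \<open>x - p\<close> cannot be shortened along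
  \<open>y\<close>.\<close>

lemma ex_orth_decomposition:
  assumes S: "complex_vector.subspace S" "S \<subseteq> hcarrier H"
    and closed: "htopology H closure_of S \<subseteq> S" and x: "x \<in> hcarrier H"
  shows "\<exists>p\<in>S. x - p \<in> orth_complement H S"
proof -
  obtain p where p: "p \<in> S" "\<And>y. y \<in> S \<Longrightarrow> hnorm H (x - p) \<le> hnorm H (x - y)"
    using ex_minimal_distance[OF assms] by blast
  have pH: "x - p \<in> hcarrier H"
    using p(1) S(2) x diff_mem by blast
  have "hinner H (x - p) y = 0" if y: "y \<in> S" for y
  proof (rule minimal_imp_orthogonal[OF pH])
    show "y \<in> hcarrier H"
      using y S(2) by blast
    show "hnorm H (x - p) \<le> hnorm H (x - p - c *\<^sub>C y)" for c
      using p(2)[of "p + c *\<^sub>C y"] p(1) y S(1)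
      by (simp add: complex_vector.subspace_add complex_vector.subspace_scale diff_diff_eq)
  qed
  then show ?thesis
    using p(1) pH by (auto simp: orth_complement_def)
qed

text \<open>Stated for projections onto complements because the parallel sum projects onto the
  complement of \<open>M\<close>. The projection is the second summand of the decomposition of
  \<open>x\<close> along \<open>S\<close>.\<close>

lemma orth_projection_orth_complement:
  assumes S: "complex_vector.subspace S" "S \<subseteq> hcarrier H"
    and closed: "htopology H closure_of S \<subseteq> S" and x: "x \<in> hcarrier H"
  shows "orth_projection H (orth_complement H S) x \<in> orth_complement H S"
    and "x - orth_projection H (orth_complement H S) x \<in> S"
proof -
  obtain p where p: "p \<in> S" "x - p \<in> orth_complement H S"
    using ex_orth_decomposition[OF assms] by blast
  \<comment> \<open>The residual of \<open>x - p\<close> is \<open>p\<close>, which must therefore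
    be orthogonal to the complement of \<open>S\<close>.\<close>
  have "p \<in> orth_complement H (orth_complement H S)"
    using p(1) S(2) hinner_commute by (fastforce simp: orth_complement_def)
  then have "orth_projection H (orth_complement H S) x = x - p"
    using p(2) S(2) orth_complementD(1)
    by (intro orth_projection_eqI subspace_orth_complement) auto
  then show "orth_projection H (orth_complement H S) x \<in> orth_complement H S"
      "x - orth_projection H (orth_complement H S) x \<in> S"
    using p by simp_all
qed

end

section \<open>Cyclic subspaces of representations\<close>

text \<open>No cyclic vector is included: the direct sum, whose cyclicity is in question, and the
  representation of an arbitrary dominated functional are to be instances too.\<close>

locale hilbert_representation = hilbert_space H
  for H :: "'v::complex_vector hspace" +
  fixes \<pi> :: "'a::star_algebra \<Rightarrow> 'v \<Rightarrow> 'v"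
  assumes star_representation: "star_representation H \<pi>"
begin

lemma rep_mem: "x \<in> hcarrier H \<Longrightarrow> \<pi> a x \<in> hcarrier H"
  and rep_vector_add: "x \<in> hcarrier H \<Longrightarrow> y \<in> hcarrier H \<Longrightarrow> \<pi> a (x + y) = \<pi> a x + \<pi> a y"
  and rep_vector_scaleC: "x \<in> hcarrier H \<Longrightarrow> \<pi> a (c *\<^sub>C x) = c *\<^sub>C \<pi> a x"
  and rep_bounded: "\<exists>C. \<forall>x\<in>hcarrier H. hnorm H (\<pi> a x) \<le> C * hnorm H x"
  and rep_add: "x \<in> hcarrier H \<Longrightarrow> \<pi> (a + b) x = \<pi> a x + \<pi> b x"
  and rep_scaleC: "x \<in> hcarrier H \<Longrightarrow> \<pi> (c *\<^sub>C a) x = c *\<^sub>C \<pi> a x"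
  and rep_mult: "x \<in> hcarrier H \<Longrightarrow> \<pi> (a * b) x = \<pi> a (\<pi> b x)"
  and rep_star: "x \<in> hcarrier H \<Longrightarrow> y \<in> hcarrier H \<Longrightarrow>
      hinner H (\<pi> (a\<^sup>\<star>) x) y = hinner H x (\<pi> a y)"
  using star_representation by (simp_all add: star_representation_def bounded_operator_def)

lemma rep_vector_diff:
  assumes "x \<in> hcarrier H" "y \<in> hcarrier H"
  shows "\<pi> a (x - y) = \<pi> a x - \<pi> a y"
  using rep_vector_add[of "x - y" y a] assms diff_mem by (simp add: eq_diff_eq)

lemma rep_vector_zero: "\<pi> a 0 = 0"
  using rep_vector_diff[OF zero_mem zero_mem] by simp

lemma rep_vector_minus: "x \<in> hcarrier H \<Longrightarrow> \<pi> a (- x) = - \<pi> a x"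
  using rep_vector_diff[OF zero_mem, of x a] rep_vector_zero by simp

lemma rep_diff:
  assumes "x \<in> hcarrier H"
  shows "\<pi> (a - b) x = \<pi> a x - \<pi> b x"
  using rep_add[OF assms, of "a - b" b] by (simp add: eq_diff_eq)

lemma rep_zero:
  assumes "x \<in> hcarrier H"
  shows "\<pi> 0 x = 0"
  using rep_diff[OF assms, of 0 0] by simp

lemma hinner_rep_star_mult:
  assumes "x \<in> hcarrier H"
  shows "hinner H (\<pi> (a\<^sup>\<star> * b) x) x = hinner H (\<pi> b x) (\<pi> a x)"
  using assms by (simp add: rep_mult rep_star rep_mem)

lemma hinner_rep_star_mult_self:
  assumes "x \<in> hcarrier H"
  shows "hinner H (\<pi> (a\<^sup>\<star> * a) x) x = complex_of_real ((hnorm H (\<pi> a x))\<^sup>2)"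
  using assms by (simp add: hinner_rep_star_mult hinner_self(1) rep_mem)

section \<open>Orbits, their closures and invariance\<close>

definition orbit :: "'v \<Rightarrow> 'v set"
  where "orbit x = {\<pi> a x |a. True}"

definition cyclic_subspace :: "'v \<Rightarrow> 'v set"
  where "cyclic_subspace x = htopology H closure_of orbit x"

lemma orbit_subset: "x \<in> hcarrier H \<Longrightarrow> orbit x \<subseteq> hcarrier H"
  by (auto simp: orbit_def rep_mem)

lemma subspace_orbit:
  assumes "x \<in> hcarrier H"
  shows "complex_vector.subspace (orbit x)"
proof (rule complex_vector.subspaceI)
  show "0 \<in> orbit x"
    unfolding orbit_def using rep_zero[OF assms] by (intro CollectI exI[of _ 0]) simp
  show "y + z \<in> orbit x" if yz: "y \<in> orbit x" "z \<in> orbit x" for y z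
  proof -
    obtain a b where "y = \<pi> a x" "z = \<pi> b x"
      using yz by (auto simp: orbit_def)
    then show ?thesis
      unfolding orbit_def using rep_add[OF assms, of a b] by (intro CollectI exI[of _ "a + b"]) simp
  qed
  show "c *\<^sub>C y \<in> orbit x" if y: "y \<in> orbit x" for c y
  proof -
    obtain a where "y = \<pi> a x"
      using y by (auto simp: orbit_def)
    then show ?thesis
      unfolding orbit_def using rep_scaleC[OF assms, of c a]
      by (intro CollectI exI[of _ "c *\<^sub>C a"]) simp
  qed
qed

lemma cyclic_subspace_iff_sequence:
  assumes "x \<in> hcarrier H"
  shows "y \<in> cyclic_subspace x \<longleftrightarrow>
    y \<in> hcarrier H \<and> (\<exists>s. (\<lambda>n. hnorm H (\<pi> (s n) x - y)) \<longlonglongrightarrow> 0)"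
proof -
  have *: "(\<forall>n. t n \<in> orbit x) \<longleftrightarrow> (\<exists>s. t = (\<lambda>n. \<pi> (s n) x))" for t :: "nat \<Rightarrow> 'v"
    by (simp add: orbit_def fun_eq_iff choice_iff)
  show ?thesis
    unfolding cyclic_subspace_def closure_of_iff_sequence[OF orbit_subset[OF assms]] *
    by blast
qed

lemma cyclic_subspace_mem: "y \<in> cyclic_subspace x \<Longrightarrow> y \<in> hcarrier H"
  unfolding cyclic_subspace_def by (rule closure_of_mem)

lemma rep_mem_cyclic_subspace:
  assumes "x \<in> hcarrier H"
  shows "\<pi> a x \<in> cyclic_subspace x"
  using closure_of_superset[OF orbit_subset[OF assms]]
  by (auto simp: cyclic_subspace_def orbit_def)

lemma subspace_cyclic_subspace:
  "x \<in> hcarrier H \<Longrightarrow> complex_vector.subspace (cyclic_subspace x)"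
  unfolding cyclic_subspace_def by (intro closure_of_subspace subspace_orbit orbit_subset)

lemma cyclic_subspace_closed: "htopology H closure_of cyclic_subspace x \<subseteq> cyclic_subspace x"
  by (simp add: cyclic_subspace_def)

text \<open>If \<open>\<pi> (s n) x\<close> tends to \<open>y\<close>, then
  \<open>\<pi> (a * s n) x\<close> tends to \<open>\<pi> a y\<close>, since \<open>\<pi> a\<close>
  is bounded.\<close>

lemma cyclic_subspace_invariant:
  assumes x: "x \<in> hcarrier H" and y: "y \<in> cyclic_subspace x"
  shows "\<pi> a y \<in> cyclic_subspace x"
proof -
  obtain s where s: "(\<lambda>n. hnorm H (\<pi> (s n) x - y)) \<longlonglongrightarrow> 0" and yH: "y \<in> hcarrier H"
    using y cyclic_subspace_iff_sequence[OF x] by blast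
  obtain C where C: "\<And>z. z \<in> hcarrier H \<Longrightarrow> hnorm H (\<pi> a z) \<le> C * hnorm H z"
    using rep_bounded by blast
  have "(\<lambda>n. hnorm H (\<pi> (a * s n) x - \<pi> a y)) \<longlonglongrightarrow> 0"
  proof (rule tendsto_sandwich[OF _ _ tendsto_const tendsto_mult_right_zero[OF s]])
    show "\<forall>\<^sub>F n in sequentially. 0 \<le> hnorm H (\<pi> (a * s n) x - \<pi> a y)"
      by (simp add: x yH rep_mem diff_mem hinner_self(2))
    show "\<forall>\<^sub>F n in sequentially.
        hnorm H (\<pi> (a * s n) x - \<pi> a y) \<le> C * hnorm H (\<pi> (s n) x - y)"
      using C[of "\<pi> (s _) x - y"] x yH by (simp add: rep_mult rep_vector_diff rep_mem diff_mem)
  qed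
  then show ?thesis
    unfolding cyclic_subspace_iff_sequence[OF x] using rep_mem[OF yH] by auto
qed

text \<open>Moving \<open>\<pi> a\<close> to the other argument turns it into the operator of
  \<open>a\<^sup>\<star>\<close>, which also preserves the cyclic subspace.\<close>

lemma orth_cyclic_subspace_invariant:
  assumes x: "x \<in> hcarrier H" and y: "y \<in> orth_complement H (cyclic_subspace x)"
  shows "\<pi> a y \<in> orth_complement H (cyclic_subspace x)"
proof -
  have "hinner H (\<pi> a y) z = 0" if z: "z \<in> cyclic_subspace x" for z
    using rep_star[OF orth_complementD(1)[OF y] cyclic_subspace_mem[OF z], of "a\<^sup>\<star>"]
      orth_complementD(2)[OF y cyclic_subspace_invariant[OF x z], of "a\<^sup>\<star>"]
    by (simp only: star_star)
  then show ?thesis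
    using orth_complementD(1)[OF y] by (simp add: orth_complement_def rep_mem)
qed

text \<open>The cyclic subspace and its complement are both invariant, so \<open>\<pi> a z\<close>
  is the orthogonal sum of \<open>\<pi> a y\<close> and \<open>\<pi> a (z - y)\<close>. This is the
  source of the domination of the parallel sum by \<open>f\<close> and \<open>g\<close>.\<close>

lemma hnorm_rep_le:
  assumes x: "x \<in> hcarrier H" and y: "y \<in> orth_complement H (cyclic_subspace x)"
    and zy: "z - y \<in> cyclic_subspace x"
  shows "hnorm H (\<pi> a y) \<le> hnorm H (\<pi> a z)"
proof -
  have yH: "y \<in> hcarrier H" and wH: "z - y \<in> hcarrier H"
    using orth_complementD(1)[OF y] cyclic_subspace_mem[OF zy] by auto
  have "hinner H (\<pi> a y) (\<pi> a (z - y)) = 0"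
    using orth_complementD(2)[OF orth_cyclic_subspace_invariant[OF x y]
        cyclic_subspace_invariant[OF x zy]] .
  then have "(hnorm H (\<pi> a y + \<pi> a (z - y)))\<^sup>2
      = (hnorm H (\<pi> a y))\<^sup>2 + (hnorm H (\<pi> a (z - y)))\<^sup>2"
    using yH wH by (intro pythagoras rep_mem)
  moreover have "\<pi> a y + \<pi> a (z - y) = \<pi> a z"
    using rep_vector_add[OF yH wH, of a] by simp
  moreover have "z \<in> hcarrier H"
    using add_mem[OF yH wH] by simp
  ultimately have "(hnorm H (\<pi> a y))\<^sup>2 \<le> (hnorm H (\<pi> a z))\<^sup>2" and "0 \<le> hnorm H (\<pi> a z)"
    using hinner_self(2)[OF rep_mem, of z a] by simp_all
  then show ?thesis
    by (rule power2_le_imp_le)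
qed

text \<open>The common-kernel form of nondegeneracy is used because it passes to direct sums
  component by component, whereas cyclicity does not.\<close>

definition nondegenerate :: bool
  where "nondegenerate \<longleftrightarrow> (\<forall>x\<in>hcarrier H. (\<forall>a. \<pi> a x = 0) \<longrightarrow> x = 0)"

text \<open>The algebra has no unit, so \<open>x\<close> need not lie in its own orbit.\<close>

lemma mem_cyclic_subspace_self:
  assumes "nondegenerate" and x: "x \<in> hcarrier H"
  shows "x \<in> cyclic_subspace x"
proof -
  have "cyclic_subspace x \<subseteq> hcarrier H"
    using cyclic_subspace_mem by (rule subsetI)
  from ex_orth_decomposition[OF subspace_cyclic_subspace[OF x] this cyclic_subspace_closed x]
  obtain p where p: "p \<in> cyclic_subspace x" "x - p \<in> orth_complement H (cyclic_subspace x)"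
    by blast
  have pH: "p \<in> hcarrier H"
    using p(1) by (rule cyclic_subspace_mem)
  \<comment> \<open>The vector lies in the complement because \<open>x - p\<close> does, and in the
    cyclic subspace because both \<open>\<pi> a x\<close> and \<open>\<pi> a p\<close> do. So all
    operators kill the part of \<open>x\<close> outside its cyclic subspace.\<close>
  have "\<pi> a (x - p) = 0" for a
  proof (rule orth_complement_Int[where S = "cyclic_subspace x"])
    show "\<pi> a (x - p) \<in> orth_complement H (cyclic_subspace x)"
      using orth_cyclic_subspace_invariant[OF x p(2)] .
    show "\<pi> a (x - p) \<in> cyclic_subspace x"
      using complex_vector.subspace_diff[OF subspace_cyclic_subspace[OF x]
          rep_mem_cyclic_subspace[OF x] cyclic_subspace_invariant[OF x p(1)]]
      by (simp add: rep_vector_diff x pH)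
  qed
  then have "x - p = 0"
    using \<open>nondegenerate\<close> diff_mem[OF x pH] by (auto simp: nondegenerate_def)
  then show ?thesis
    using p(1) by simp
qed

lemma cyclic_vector_iff:
  "cyclic_vector H \<pi> x \<longleftrightarrow> x \<in> hcarrier H \<and> cyclic_subspace x = hcarrier H"
  by (simp add: cyclic_vector_def cyclic_subspace_def orbit_def)

text \<open>A vector \<open>y\<close> killed by every operator is orthogonal to the orbit of
  \<open>x\<close>, as \<open>\<pi> a\<close> can be moved onto \<open>y\<close> in the form
  \<open>\<pi> (a\<^sup>\<star>)\<close>. The orbit is dense.\<close>

lemma cyclic_vector_imp_nondegenerate:
  assumes "cyclic_vector H \<pi> x"
  shows "nondegenerate"
  unfolding nondegenerate_def
proof (intro ballI impI)
  fix y assume y: "y \<in> hcarrier H" "\<forall>a. \<pi> a y = 0"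
  have x: "x \<in> hcarrier H" and cyc: "cyclic_subspace x = hcarrier H"
    using assms by (simp_all add: cyclic_vector_iff)
  have "hinner H y (\<pi> a x) = 0" for a
    using rep_star[OF y(1) x, of a] y(2) x by (simp add: hinner_zero_left)
  then have "y \<in> orth_complement H (orbit x)"
    using y(1) by (auto simp: orth_complement_def orbit_def)
  then have "y \<in> orth_complement H (cyclic_subspace x)"
    by (simp add: cyclic_subspace_def orth_complement_closure_of orbit_subset x)
  then show "y = 0"
    using orth_complement_Int y(1) cyc by blast
qed

end

section \<open>Direct sums\<close>

lemma hcarrier_direct_sum: "hcarrier (H \<oplus>\<^sub>H K) = hcarrier H \<times> hcarrier K"
  by (simp add: direct_sum_def)

lemma pre_hilbert_space_direct_sum:
  assumes "pre_hilbert_space H" "pre_hilbert_space K"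
  shows "pre_hilbert_space (H \<oplus>\<^sub>H K)"
proof -
  interpret H: pre_hilbert_space H by (rule assms)
  interpret K: pre_hilbert_space K by (rule assms)
  show ?thesis
  proof
    show "complex_vector.subspace (hcarrier (H \<oplus>\<^sub>H K))"
      by (rule complex_vector.subspaceI)
        (auto simp: direct_sum_def zero_prod_def scaleC_prod_def H.zero_mem K.zero_mem
          H.add_mem K.add_mem H.scaleC_mem K.scaleC_mem)
    show "hinner (H \<oplus>\<^sub>H K) (x + y) z = hinner (H \<oplus>\<^sub>H K) x z + hinner (H \<oplus>\<^sub>H K) y z"
      if "x \<in> hcarrier (H \<oplus>\<^sub>H K)" "y \<in> hcarrier (H \<oplus>\<^sub>H K)" "z \<in> hcarrier (H \<oplus>\<^sub>H K)" for x y z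
      using that by (auto simp: direct_sum_def H.hinner_add_left K.hinner_add_left)
    show "hinner (H \<oplus>\<^sub>H K) (c *\<^sub>C x) y = c * hinner (H \<oplus>\<^sub>H K) x y"
      if "x \<in> hcarrier (H \<oplus>\<^sub>H K)" "y \<in> hcarrier (H \<oplus>\<^sub>H K)" for x y c
      using that
      by (auto simp: direct_sum_def scaleC_prod_def H.hinner_scaleC_left K.hinner_scaleC_left
          distrib_left)
    show "hinner (H \<oplus>\<^sub>H K) x y = cnj (hinner (H \<oplus>\<^sub>H K) y x)"
      if "x \<in> hcarrier (H \<oplus>\<^sub>H K)" "y \<in> hcarrier (H \<oplus>\<^sub>H K)" for x y
    proof -
      have "hinner H (fst x) (fst y) = cnj (hinner H (fst y) (fst x))"
          "hinner K (snd x) (snd y) = cnj (hinner K (snd y) (snd x))"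
        using that by (auto simp: hcarrier_direct_sum intro: H.hinner_commute K.hinner_commute)
      then show ?thesis
        by (simp add: direct_sum_def)
    qed
    show "0 < hinner (H \<oplus>\<^sub>H K) x x" if x: "x \<in> hcarrier (H \<oplus>\<^sub>H K)" "x \<noteq> 0" for x
    proof -
      obtain u v where uv: "x = (u, v)" "u \<in> hcarrier H" "v \<in> hcarrier K"
        using x(1) by (auto simp: hcarrier_direct_sum)
      have "u \<noteq> 0 \<or> v \<noteq> 0"
        using x(2) uv(1) by (auto simp: zero_prod_def)
      then have "0 < (hnorm H u)\<^sup>2 + (hnorm K v)\<^sup>2"
        using H.hinner_self(3)[OF uv(2)] K.hinner_self(3)[OF uv(3)]
        by (simp add: sum_power2_gt_zero_iff)
      then show ?thesis
        by (simp add: uv(1) direct_sum_def H.hinner_self(1)[OF uv(2)] K.hinner_self(1)[OF uv(3)]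
            less_complex_def flip: of_real_add of_real_power)
    qed
  qed
qed

text \<open>These estimates reduce convergence, completeness and boundedness in the sum to the two
  components.\<close>

lemma hnorm_direct_sum_le:
  assumes "pre_hilbert_space H" "pre_hilbert_space K" "x \<in> hcarrier H" "y \<in> hcarrier K"
  shows "hnorm H x \<le> hnorm (H \<oplus>\<^sub>H K) (x, y)"
    and "hnorm K y \<le> hnorm (H \<oplus>\<^sub>H K) (x, y)"
    and "hnorm (H \<oplus>\<^sub>H K) (x, y) \<le> hnorm H x + hnorm K y"
proof -
  have "hnorm (H \<oplus>\<^sub>H K) (x, y) = sqrt ((hnorm H x)\<^sup>2 + (hnorm K y)\<^sup>2)"
    using assms by (simp add: hnorm_def[of "H \<oplus>\<^sub>H K" for H K] pre_hilbert_space.hnorm_square)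
      (simp add: direct_sum_def)
  then show "hnorm H x \<le> hnorm (H \<oplus>\<^sub>H K) (x, y)"
    and "hnorm K y \<le> hnorm (H \<oplus>\<^sub>H K) (x, y)"
    and "hnorm (H \<oplus>\<^sub>H K) (x, y) \<le> hnorm H x + hnorm K y"
    using pre_hilbert_space.hinner_self(2)[OF assms(1,3)]
      pre_hilbert_space.hinner_self(2)[OF assms(2,4)]
      sqrt_add_le_add_sqrt[of "(hnorm H x)\<^sup>2" "(hnorm K y)\<^sup>2"]
    by (simp_all add: real_le_rsqrt)
qed

lemma hilbert_space_direct_sum:
  assumes "hilbert_space H" "hilbert_space K"
  shows "hilbert_space (H \<oplus>\<^sub>H K)"
proof -
  interpret H: hilbert_space H by (rule assms)
  interpret K: hilbert_space K by (rule assms)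
  interpret S: pre_hilbert_space "H \<oplus>\<^sub>H K"
    by (intro pre_hilbert_space_direct_sum H.pre_hilbert_space_axioms K.pre_hilbert_space_axioms)
  note norm_le = hnorm_direct_sum_le[OF H.pre_hilbert_space_axioms K.pre_hilbert_space_axioms]
  show ?thesis
  proof (unfold_locales, unfold S.mcomplete_iff, intro allI impI, elim conjE)
    fix s :: "nat \<Rightarrow> 'a \<times> 'b"
    assume s: "range s \<subseteq> hcarrier (H \<oplus>\<^sub>H K)"
      and cauchy: "\<forall>e>0. \<exists>N. \<forall>n m. N \<le> n \<longrightarrow> N \<le> m \<longrightarrow> hnorm (H \<oplus>\<^sub>H K) (s n - s m) < e"
    define t u where "t = (\<lambda>n. fst (s n))" and "u = (\<lambda>n. snd (s n))"
    have s_eq: "s n = (t n, u n)" for n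
      by (simp add: t_def u_def)
    have mem: "t n \<in> hcarrier H" "u n \<in> hcarrier K" for n
      using s by (auto simp: hcarrier_direct_sum s_eq)
    have le: "hnorm H (t n - t m) \<le> hnorm (H \<oplus>\<^sub>H K) (s n - s m)"
        "hnorm K (u n - u m) \<le> hnorm (H \<oplus>\<^sub>H K) (s n - s m)" for n m
      using norm_le(1,2)[of "t n - t m" "u n - u m"] mem
      by (simp_all add: s_eq H.diff_mem K.diff_mem)
    have "\<forall>e>0. \<exists>N. \<forall>n m. N \<le> n \<longrightarrow> N \<le> m \<longrightarrow> hnorm H (t n - t m) < e"
        "\<forall>e>0. \<exists>N. \<forall>n m. N \<le> n \<longrightarrow> N \<le> m \<longrightarrow> hnorm K (u n - u m) < e"
      using cauchy le by (meson le_less_trans)+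
    then obtain x y where xy: "x \<in> hcarrier H" "y \<in> hcarrier K"
        "(\<lambda>n. hnorm H (t n - x)) \<longlonglongrightarrow> 0" "(\<lambda>n. hnorm K (u n - y)) \<longlonglongrightarrow> 0"
      using H.complete K.complete mem unfolding H.mcomplete_iff K.mcomplete_iff
      by (metis image_subsetI)
    have mem': "t n - x \<in> hcarrier H" "u n - y \<in> hcarrier K" for n
      using mem xy by (simp_all add: H.diff_mem K.diff_mem)
    have "(\<lambda>n. hnorm (H \<oplus>\<^sub>H K) (s n - (x, y))) \<longlonglongrightarrow> 0"
    proof (rule tendsto_sandwich[OF _ _ tendsto_const])
      show "(\<lambda>n. hnorm H (t n - x) + hnorm K (u n - y)) \<longlonglongrightarrow> 0"
        using tendsto_add[OF xy(3,4)] by simp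
      show "\<forall>\<^sub>F n in sequentially. hnorm (H \<oplus>\<^sub>H K) (s n - (x, y)) \<le> hnorm H (t n - x) + hnorm K (u n - y)"
        using norm_le(3)[OF mem'] by (simp add: s_eq)
      show "\<forall>\<^sub>F n in sequentially. 0 \<le> hnorm (H \<oplus>\<^sub>H K) (s n - (x, y))"
        using S.hinner_self(2)[of "s _ - (x, y)"] mem' by (simp add: s_eq hcarrier_direct_sum)
    qed
    then show "\<exists>z\<in>hcarrier (H \<oplus>\<^sub>H K). (\<lambda>n. hnorm (H \<oplus>\<^sub>H K) (s n - z)) \<longlonglongrightarrow> 0"
      using xy(1,2) by (intro bexI[of _ "(x, y)"]) (simp_all add: hcarrier_direct_sum)
  qed
qed

lemma rep_sum_apply: "(\<pi> \<oplus>\<^sub>r \<rho>) a (x, y) = (\<pi> a x, \<rho> a y)"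
  by (simp add: rep_sum_def)

lemma hilbert_representation_rep_sum:
  assumes "hilbert_representation H \<pi>" "hilbert_representation K \<rho>"
  shows "hilbert_representation (H \<oplus>\<^sub>H K) (\<pi> \<oplus>\<^sub>r \<rho>)"
proof -
  interpret H: hilbert_representation H \<pi> by (rule assms)
  interpret K: hilbert_representation K \<rho> by (rule assms)
  interpret S: hilbert_space "H \<oplus>\<^sub>H K"
    by (intro hilbert_space_direct_sum H.hilbert_space_axioms K.hilbert_space_axioms)
  note norm_le = hnorm_direct_sum_le[OF H.pre_hilbert_space_axioms K.pre_hilbert_space_axioms]
  have "\<exists>C. \<forall>z\<in>hcarrier (H \<oplus>\<^sub>H K). hnorm (H \<oplus>\<^sub>H K) ((\<pi> \<oplus>\<^sub>r \<rho>) a z) \<le> C * hnorm (H \<oplus>\<^sub>H K) z" for a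
  proof -
    obtain C D where CD: "\<And>x. x \<in> hcarrier H \<Longrightarrow> hnorm H (\<pi> a x) \<le> C * hnorm H x"
        "\<And>y. y \<in> hcarrier K \<Longrightarrow> hnorm K (\<rho> a y) \<le> D * hnorm K y"
      using H.rep_bounded K.rep_bounded by metis
    \<comment> \<open>On a zero space the bounding constant may be negative, hence the absolute
      values.\<close>
    have "hnorm (H \<oplus>\<^sub>H K) (\<pi> a x, \<rho> a y) \<le> (\<bar>C\<bar> + \<bar>D\<bar>) * hnorm (H \<oplus>\<^sub>H K) (x, y)"
      if xy: "x \<in> hcarrier H" "y \<in> hcarrier K" for x y
    proof -
      have "hnorm (H \<oplus>\<^sub>H K) (\<pi> a x, \<rho> a y) \<le> C * hnorm H x + D * hnorm K y"
        using norm_le(3)[OF H.rep_mem[OF xy(1)] K.rep_mem[OF xy(2)], of a a] CD(1)[OF xy(1)]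
          CD(2)[OF xy(2)] by simp
      also have "\<dots> \<le> \<bar>C\<bar> * hnorm (H \<oplus>\<^sub>H K) (x, y) + \<bar>D\<bar> * hnorm (H \<oplus>\<^sub>H K) (x, y)"
        using norm_le(1,2)[OF xy] H.hinner_self(2)[OF xy(1)] K.hinner_self(2)[OF xy(2)]
        by (intro add_mono mult_mono) auto
      finally show ?thesis
        by (simp add: distrib_right)
    qed
    then show ?thesis
      by (auto simp: hcarrier_direct_sum rep_sum_apply)
  qed
  then have "star_representation (H \<oplus>\<^sub>H K) (\<pi> \<oplus>\<^sub>r \<rho>)"
    unfolding star_representation_def bounded_operator_def
    by (auto simp: hcarrier_direct_sum rep_sum_apply scaleC_prod_def H.rep_mem K.rep_mem
        H.rep_vector_add K.rep_vector_add H.rep_vector_scaleC K.rep_vector_scaleC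
        H.rep_add K.rep_add H.rep_scaleC K.rep_scaleC H.rep_mult K.rep_mult)
      (simp add: direct_sum_def H.rep_star K.rep_star)
  then show ?thesis
    by unfold_locales
qed

section \<open>Pairs of GNS-triples\<close>

text \<open>The hypotheses are symmetric in the two triples, so every result is also available with
  \<open>f\<close> and \<open>g\<close> exchanged.\<close>

locale gns_pair =
  fixes f g :: "'a::star_algebra \<Rightarrow> complex"
    and Hf :: "'v::complex_vector hspace" and \<pi>f :: "'a \<Rightarrow> 'v \<Rightarrow> 'v" and \<zeta>f :: 'v
    and Hg :: "'w::complex_vector hspace" and \<pi>g :: "'a \<Rightarrow> 'w \<Rightarrow> 'w" and \<zeta>g :: 'w
  assumes gns_f: "gns_triple f Hf \<pi>f \<zeta>f" and gns_g: "gns_triple g Hg \<pi>g \<zeta>g"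

sublocale gns_pair \<subseteq> F: hilbert_representation Hf \<pi>f
  using gns_f
  by (simp add: gns_triple_def hilbert_representation_def hilbert_representation_axioms_def)

sublocale gns_pair \<subseteq> G: hilbert_representation Hg \<pi>g
  using gns_g
  by (simp add: gns_triple_def hilbert_representation_def hilbert_representation_axioms_def)

sublocale gns_pair \<subseteq> S: hilbert_representation "Hf \<oplus>\<^sub>H Hg" "\<pi>f \<oplus>\<^sub>r \<pi>g"
  by (intro hilbert_representation_rep_sum F.hilbert_representation_axioms
      G.hilbert_representation_axioms)

context gns_pair
begin

section \<open>The closed graph \<open>M\<close> as a cyclic subspace\<close>

abbreviation M :: "('v \<times> 'w) set"
  where "M \<equiv> gns_graph_closure Hf \<pi>f \<zeta>f Hg \<pi>g \<zeta>g"

lemma \<zeta>f_cyclic: "cyclic_vector Hf \<pi>f \<zeta>f" and f_eq: "f a = hinner Hf (\<pi>f a \<zeta>f) \<zeta>f"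
  and \<zeta>g_cyclic: "cyclic_vector Hg \<pi>g \<zeta>g" and g_eq: "g a = hinner Hg (\<pi>g a \<zeta>g) \<zeta>g"
  using gns_f gns_g by (simp_all add: gns_triple_def)

lemma \<zeta>f_mem: "\<zeta>f \<in> hcarrier Hf" and \<zeta>g_mem: "\<zeta>g \<in> hcarrier Hg"
  using \<zeta>f_cyclic \<zeta>g_cyclic by (simp_all add: cyclic_vector_def)

lemma \<zeta>_mem: "(\<zeta>f, \<zeta>g) \<in> hcarrier (Hf \<oplus>\<^sub>H Hg)"
  and \<zeta>f_0_mem: "(\<zeta>f, 0) \<in> hcarrier (Hf \<oplus>\<^sub>H Hg)"
  by (simp_all add: hcarrier_direct_sum \<zeta>f_mem \<zeta>g_mem F.zero_mem G.zero_mem)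

lemma f_star_mult: "f (a\<^sup>\<star> * a) = complex_of_real ((hnorm Hf (\<pi>f a \<zeta>f))\<^sup>2)"
  and g_star_mult: "g (a\<^sup>\<star> * a) = complex_of_real ((hnorm Hg (\<pi>g a \<zeta>g))\<^sup>2)"
  using F.hinner_rep_star_mult_self[OF \<zeta>f_mem] G.hinner_rep_star_mult_self[OF \<zeta>g_mem]
  by (simp_all add: f_eq g_eq)

lemma graph_eq_orbit: "{(\<pi>f a \<zeta>f, \<pi>g a \<zeta>g) |a. True} = S.orbit (\<zeta>f, \<zeta>g)"
  by (simp add: S.orbit_def rep_sum_apply)

lemma M_eq: "M = S.cyclic_subspace (\<zeta>f, \<zeta>g)"
  unfolding gns_graph_closure_def S.cyclic_subspace_def graph_eq_orbit ..

lemma subspace_M: "complex_vector.subspace M"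
  using S.subspace_cyclic_subspace[OF \<zeta>_mem] by (simp add: M_eq)

lemma M_subset: "M \<subseteq> hcarrier (Hf \<oplus>\<^sub>H Hg)"
  using S.cyclic_subspace_mem by (auto simp: M_eq)

lemma nondegenerate_sum: "S.nondegenerate"
  unfolding S.nondegenerate_def
proof (intro ballI impI)
  fix z assume "z \<in> hcarrier (Hf \<oplus>\<^sub>H Hg)" and z: "\<forall>a. (\<pi>f \<oplus>\<^sub>r \<pi>g) a z = 0"
  then have mem: "fst z \<in> hcarrier Hf" "snd z \<in> hcarrier Hg"
    by (auto simp: hcarrier_direct_sum)
  have "\<forall>a. \<pi>f a (fst z) = 0" "\<forall>a. \<pi>g a (snd z) = 0"
    using z rep_sum_apply[of \<pi>f \<pi>g _ "fst z" "snd z"] by (simp_all add: zero_prod_def)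
  then show "z = 0"
    using F.cyclic_vector_imp_nondegenerate[OF \<zeta>f_cyclic] G.cyclic_vector_imp_nondegenerate[OF \<zeta>g_cyclic]
      mem by (simp add: F.nondegenerate_def G.nondegenerate_def prod_eq_iff)
qed

lemma \<zeta>_mem_M: "(\<zeta>f, \<zeta>g) \<in> M"
  unfolding M_eq by (rule S.mem_cyclic_subspace_self[OF nondegenerate_sum \<zeta>_mem])

lemma M_eq_whole_iff_cyclic:
  "M = hcarrier (Hf \<oplus>\<^sub>H Hg) \<longleftrightarrow> cyclic_vector (Hf \<oplus>\<^sub>H Hg) (\<pi>f \<oplus>\<^sub>r \<pi>g) (\<zeta>f, \<zeta>g)"
  by (simp add: S.cyclic_vector_iff M_eq \<zeta>_mem)

text \<open>The two vectors add up to \<open>(\<zeta>f, \<zeta>g)\<close>, which belongs to the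
  subspace \<open>M\<close>.\<close>

lemma \<zeta>f_in_M_iff_\<zeta>g_in_M: "(\<zeta>f, 0) \<in> M \<longleftrightarrow> (0, \<zeta>g) \<in> M"
  using complex_vector.subspace_diff[OF subspace_M \<zeta>_mem_M, of "(\<zeta>f, 0)"]
    complex_vector.subspace_diff[OF subspace_M \<zeta>_mem_M, of "(0, \<zeta>g)"]
  by auto

text \<open>A single sequence in the algebra has to serve both components. The arguments on
  semisingularity and mutual singularity use \<open>M\<close> in this form.\<close>

lemma M_iff:
  "(x, y) \<in> M \<longleftrightarrow> x \<in> hcarrier Hf \<and> y \<in> hcarrier Hg \<and>
    (\<exists>s. (\<lambda>n. hnorm Hf (\<pi>f (s n) \<zeta>f - x)) \<longlonglongrightarrow> 0 \<and> (\<lambda>n. hnorm Hg (\<pi>g (s n) \<zeta>g - y)) \<longlonglongrightarrow> 0)"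
proof -
  have "(\<lambda>n. hnorm (Hf \<oplus>\<^sub>H Hg) ((\<pi>f \<oplus>\<^sub>r \<pi>g) (s n) (\<zeta>f, \<zeta>g) - (x, y))) \<longlonglongrightarrow> 0 \<longleftrightarrow>
      (\<lambda>n. hnorm Hf (\<pi>f (s n) \<zeta>f - x)) \<longlonglongrightarrow> 0 \<and> (\<lambda>n. hnorm Hg (\<pi>g (s n) \<zeta>g - y)) \<longlonglongrightarrow> 0"
    (is "?l \<longlonglongrightarrow> 0 \<longleftrightarrow> ?u \<longlonglongrightarrow> 0 \<and> ?v \<longlonglongrightarrow> 0")
    if "x \<in> hcarrier Hf" "y \<in> hcarrier Hg" for s :: "nat \<Rightarrow> 'a"
  proof -
    have mem: "\<pi>f (s n) \<zeta>f - x \<in> hcarrier Hf" "\<pi>g (s n) \<zeta>g - y \<in> hcarrier Hg" for n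
      using that by (simp_all add: F.diff_mem G.diff_mem F.rep_mem G.rep_mem \<zeta>f_mem \<zeta>g_mem)
    have nn: "0 \<le> ?u n" "0 \<le> ?v n" for n
      using F.hinner_self(2)[OF mem(1)] G.hinner_self(2)[OF mem(2)] by auto
    have le: "?u n \<le> ?l n" "?v n \<le> ?l n" "?l n \<le> ?u n + ?v n" for n
      using hnorm_direct_sum_le[OF F.pre_hilbert_space_axioms G.pre_hilbert_space_axioms mem]
      by (simp_all add: rep_sum_apply)
    show ?thesis
    proof (intro iffI conjI; (elim conjE)?)
      assume l: "?l \<longlonglongrightarrow> 0"
      show "?u \<longlonglongrightarrow> 0"
        by (rule tendsto_sandwich[OF _ _ tendsto_const l]) (use nn le in auto)
      show "?v \<longlonglongrightarrow> 0"
        by (rule tendsto_sandwich[OF _ _ tendsto_const l]) (use nn le in auto)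
    next
      assume uv: "?u \<longlonglongrightarrow> 0" "?v \<longlonglongrightarrow> 0"
      have "(\<lambda>n. ?u n + ?v n) \<longlonglongrightarrow> 0"
        using tendsto_add[OF uv] by simp
      moreover have "0 \<le> ?l n" for n
        using nn(1)[of n] le(1)[of n] by linarith
      ultimately show "?l \<longlonglongrightarrow> 0"
        using tendsto_sandwich[OF _ _ tendsto_const, of 0 ?l sequentially "\<lambda>n. ?u n + ?v n"] le(3)
        by simp
    qed
  qed
  then show ?thesis
    unfolding M_eq S.cyclic_subspace_iff_sequence[OF \<zeta>_mem]
    by (auto simp: hcarrier_direct_sum)
qed

text \<open>The operators fix the zero second component, so invariance of \<open>M\<close> yields
  all \<open>(\<pi>f a \<zeta>f, 0)\<close>. Cyclicity of \<open>\<zeta>f\<close> and closedness of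
  \<open>M\<close> give the rest.\<close>

lemma slice_mem_M:
  assumes "(\<zeta>f, 0) \<in> M" and x: "x \<in> hcarrier Hf"
  shows "(x, 0) \<in> M"
proof -
  have orbit: "(\<pi>f a \<zeta>f, 0) \<in> M" for a
    using S.cyclic_subspace_invariant[OF \<zeta>_mem, of "(\<zeta>f, 0)" a] assms(1)
    by (simp add: M_eq rep_sum_apply G.rep_vector_zero)
  have "x \<in> F.cyclic_subspace \<zeta>f"
    using x \<zeta>f_cyclic by (simp add: F.cyclic_vector_iff)
  then obtain s where s: "(\<lambda>n. hnorm Hf (\<pi>f (s n) \<zeta>f - x)) \<longlonglongrightarrow> 0"
    unfolding F.cyclic_subspace_iff_sequence[OF \<zeta>f_mem] by blast
  have "hnorm (Hf \<oplus>\<^sub>H Hg) ((\<pi>f (s n) \<zeta>f, 0) - (x, 0)) = hnorm Hf (\<pi>f (s n) \<zeta>f - x)" for n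
    by (simp add: hnorm_def direct_sum_def G.hinner_zero_left G.zero_mem)
  then have "(x, 0) \<in> htopology (Hf \<oplus>\<^sub>H Hg) closure_of M"
    unfolding S.closure_of_iff_sequence[OF M_subset]
    using orbit s x G.zero_mem
    by (intro conjI exI[of _ "\<lambda>n. (\<pi>f (s n) \<zeta>f, 0)"]) (simp_all add: hcarrier_direct_sum)
  then show ?thesis
    using S.cyclic_subspace_closed by (auto simp: M_eq)
qed

section \<open>Semisingularity in terms of \<open>M\<close>\<close>

lemma semisingular_iff: "semisingular f g \<longleftrightarrow> (0, \<zeta>g) \<in> M"
proof
  assume "semisingular f g"
  then obtain s where s: "(\<lambda>n. f ((s n)\<^sup>\<star> * s n)) \<longlonglongrightarrow> 0"
      "((\<lambda>(n, m). g ((s n - s m)\<^sup>\<star> * (s n - s m))) \<longlongrightarrow> 0) (sequentially \<times>\<^sub>F sequentially)"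
      "\<And>a. (\<lambda>n. g ((s n)\<^sup>\<star> * a)) \<longlonglongrightarrow> g a"
    unfolding semisingular_def by blast
  have mem: "\<pi>g (s n) \<zeta>g \<in> hcarrier Hg" for n
    by (simp add: G.rep_mem \<zeta>g_mem)
  have f0: "(\<lambda>n. hnorm Hf (\<pi>f (s n) \<zeta>f)) \<longlonglongrightarrow> 0"
    using tendsto_real_sqrt[OF tendsto_Re[OF s(1)]] F.hinner_self(2)[OF F.rep_mem[OF \<zeta>f_mem]]
    by (simp add: f_star_mult)
  have "\<exists>N. \<forall>n m. N \<le> n \<longrightarrow> N \<le> m \<longrightarrow> hnorm Hg (\<pi>g (s n) \<zeta>g - \<pi>g (s m) \<zeta>g) < e" if e: "e > 0" for e
  proof -
    \<comment> \<open>The tolerance is \<open>e\<^sup>2\<close> because the values of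
      \<open>g\<close> here are squared norms.\<close>
    have "\<forall>\<^sub>F (n, m) in sequentially \<times>\<^sub>F sequentially.
        cmod (g ((s n - s m)\<^sup>\<star> * (s n - s m))) < e\<^sup>2"
      using tendstoD[OF s(2), of "e\<^sup>2"] e by (simp add: case_prod_unfold)
    then have "\<forall>\<^sub>F (n, m) in sequentially \<times>\<^sub>F sequentially.
        hnorm Hg (\<pi>g (s n) \<zeta>g - \<pi>g (s m) \<zeta>g) < e"
      by eventually_elim
        (use e in \<open>auto simp: g_star_mult norm_power G.rep_diff \<zeta>g_mem intro: power_less_imp_less_base\<close>)
    then show ?thesis
      by (auto simp: eventually_prod_sequentially)
  qed
  then obtain y where y: "y \<in> hcarrier Hg" "(\<lambda>n. hnorm Hg (\<pi>g (s n) \<zeta>g - y)) \<longlonglongrightarrow> 0"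
    using G.complete[unfolded G.mcomplete_iff, rule_format, of "\<lambda>n. \<pi>g (s n) \<zeta>g"] mem
    by (auto simp: image_subset_iff)
  \<comment> \<open>Both sides are limits of \<open>g ((s n)\<^sup>\<star> * a)\<close>: the first
    by norm convergence to \<open>y\<close>, the second by the weak condition. Density of the orbit
    then forces \<open>y = \<zeta>g\<close>.\<close>
  have "hinner Hg (\<pi>g a \<zeta>g) y = hinner Hg (\<pi>g a \<zeta>g) \<zeta>g" for a
  proof (rule LIMSEQ_unique)
    show "(\<lambda>n. hinner Hg (\<pi>g a \<zeta>g) (\<pi>g (s n) \<zeta>g)) \<longlonglongrightarrow> hinner Hg (\<pi>g a \<zeta>g) y"
      using mem y by (intro G.hinner_tendsto G.rep_mem[OF \<zeta>g_mem])
    show "(\<lambda>n. hinner Hg (\<pi>g a \<zeta>g) (\<pi>g (s n) \<zeta>g)) \<longlonglongrightarrow> hinner Hg (\<pi>g a \<zeta>g) \<zeta>g"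
      using s(3)[of a] by (simp add: g_eq G.hinner_rep_star_mult \<zeta>g_mem)
  qed
  then have "hinner Hg (y - \<zeta>g) (\<pi>g a \<zeta>g) = 0" for a
    using G.hinner_commute[of "y - \<zeta>g" "\<pi>g a \<zeta>g"] y(1) \<zeta>g_mem
    by (simp add: G.diff_mem G.rep_mem G.hinner_diff_right)
  then have "y - \<zeta>g \<in> orth_complement Hg (G.orbit \<zeta>g)"
    using y(1) \<zeta>g_mem by (auto simp: orth_complement_def G.orbit_def G.diff_mem)
  then have "y - \<zeta>g \<in> orth_complement Hg (G.cyclic_subspace \<zeta>g)"
    by (simp add: G.cyclic_subspace_def G.orth_complement_closure_of G.orbit_subset \<zeta>g_mem)
  then have "y - \<zeta>g = 0"
    using G.orth_complement_Int[of "y - \<zeta>g"] \<zeta>g_cyclic y(1) \<zeta>g_mem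
    by (metis G.cyclic_vector_iff G.diff_mem)
  then show "(0, \<zeta>g) \<in> M"
    unfolding M_iff using f0 y F.zero_mem by auto
next
  assume "(0, \<zeta>g) \<in> M"
  then obtain s where s: "(\<lambda>n. hnorm Hf (\<pi>f (s n) \<zeta>f)) \<longlonglongrightarrow> 0"
      "(\<lambda>n. hnorm Hg (\<pi>g (s n) \<zeta>g - \<zeta>g)) \<longlonglongrightarrow> 0"
    unfolding M_iff by auto
  have mem: "\<pi>g (s n) \<zeta>g \<in> hcarrier Hg" for n
    by (simp add: G.rep_mem \<zeta>g_mem)
  have "(\<lambda>n. f ((s n)\<^sup>\<star> * s n)) \<longlonglongrightarrow> 0"
    unfolding f_star_mult
    using tendsto_of_real[OF tendsto_power[OF s(1), of 2]] by (simp del: of_real_power)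
  moreover have "((\<lambda>(n, m). g ((s n - s m)\<^sup>\<star> * (s n - s m))) \<longlongrightarrow> 0) (sequentially \<times>\<^sub>F sequentially)"
  proof (rule Lim_null_comparison)
    \<comment> \<open>The distance to the limit \<open>\<zeta>g\<close> bounds the double sequence
      by \<open>(r n + r m)\<^sup>2\<close>, which reduces the double limit to single ones.\<close>
    define r where "r = (\<lambda>n. hnorm Hg (\<pi>g (s n) \<zeta>g - \<zeta>g))"
    have "((\<lambda>p. r (fst p)) \<longlongrightarrow> 0) (sequentially \<times>\<^sub>F sequentially)"
      "((\<lambda>p. r (snd p)) \<longlongrightarrow> 0) (sequentially \<times>\<^sub>F sequentially)"
      using s(2) unfolding r_def
      by (auto intro: filterlim_compose filterlim_fst filterlim_snd)
    from tendsto_power[OF tendsto_add[OF this], of 2]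
    show "((\<lambda>p. (r (fst p) + r (snd p))\<^sup>2) \<longlongrightarrow> 0) (sequentially \<times>\<^sub>F sequentially)"
      by simp
    have "cmod (g ((s n - s m)\<^sup>\<star> * (s n - s m))) \<le> (r n + r m)\<^sup>2" for n m
      using G.hnorm_diff_triangle[OF mem \<zeta>g_mem mem, of n m]
        G.hinner_self(2)[OF G.diff_mem[OF mem mem], of n m]
      by (simp add: g_star_mult norm_power G.rep_diff \<zeta>g_mem r_def power_mono)
    then show "\<forall>\<^sub>F p in sequentially \<times>\<^sub>F sequentially.
        norm (case p of (n, m) \<Rightarrow> g ((s n - s m)\<^sup>\<star> * (s n - s m))) \<le> (r (fst p) + r (snd p))\<^sup>2"
      by (auto intro: always_eventually)
  qed
  moreover have "(\<lambda>n. g ((s n)\<^sup>\<star> * a)) \<longlonglongrightarrow> g a" for a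
    using G.hinner_tendsto[OF mem \<zeta>g_mem G.rep_mem[OF \<zeta>g_mem] s(2), of a]
    by (simp add: g_eq G.hinner_rep_star_mult \<zeta>g_mem)
  ultimately show "semisingular f g"
    unfolding semisingular_def by blast
qed

section \<open>The parallel sum as a vector functional\<close>

definition \<xi> :: "'v \<times> 'w"
  where "\<xi> = orth_projection (Hf \<oplus>\<^sub>H Hg) (orth_complement (Hf \<oplus>\<^sub>H Hg) M) (\<zeta>f, 0)"

lemma parallel_sum_eq:
  "parallel_sum Hf \<pi>f \<zeta>f Hg \<pi>g \<zeta>g a = hinner (Hf \<oplus>\<^sub>H Hg) ((\<pi>f \<oplus>\<^sub>r \<pi>g) a \<xi>) \<xi>"
  by (simp add: parallel_sum_def Let_def \<xi>_def)

lemma \<xi>_orth: "\<xi> \<in> orth_complement (Hf \<oplus>\<^sub>H Hg) M" and \<zeta>f_diff_\<xi>: "(\<zeta>f, 0) - \<xi> \<in> M"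
  using S.orth_projection_orth_complement[OF subspace_M M_subset _ \<zeta>f_0_mem] S.cyclic_subspace_closed
  by (simp_all add: M_eq \<xi>_def)

lemma \<xi>_mem: "\<xi> \<in> hcarrier (Hf \<oplus>\<^sub>H Hg)"
  using \<xi>_orth by (rule S.orth_complementD)

lemma \<xi>_eq_0_iff: "\<xi> = 0 \<longleftrightarrow> (\<zeta>f, 0) \<in> M"
proof
  assume "\<xi> = 0"
  then show "(\<zeta>f, 0) \<in> M"
    using \<zeta>f_diff_\<xi> by simp
next
  assume "(\<zeta>f, 0) \<in> M"
  then have "\<xi> \<in> M"
    using complex_vector.subspace_diff[OF subspace_M _ \<zeta>f_diff_\<xi>, of "(\<zeta>f, 0)"] by simp
  then show "\<xi> = 0"
    using \<xi>_orth by (rule S.orth_complement_Int)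
qed

text \<open>Evaluating at \<open>a\<^sup>\<star> * a\<close> gives the squared norm of the image of
  \<open>\<xi>\<close> under \<open>a\<close>; nondegeneracy then kills \<open>\<xi>\<close>
  itself.\<close>

lemma parallel_sum_eq_0_iff: "(\<forall>a. parallel_sum Hf \<pi>f \<zeta>f Hg \<pi>g \<zeta>g a = 0) \<longleftrightarrow> \<xi> = 0"
proof
  assume h: "\<forall>a. parallel_sum Hf \<pi>f \<zeta>f Hg \<pi>g \<zeta>g a = 0"
  have "(\<pi>f \<oplus>\<^sub>r \<pi>g) a \<xi> = 0" for a
    using h[rule_format, of "a\<^sup>\<star> * a"] S.hinner_self(3)[OF S.rep_mem[OF \<xi>_mem], of a]
    by (simp add: parallel_sum_eq S.hinner_rep_star_mult_self \<xi>_mem)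
  then show "\<xi> = 0"
    using nondegenerate_sum \<xi>_mem by (simp add: S.nondegenerate_def)
next
  assume "\<xi> = 0"
  then show "\<forall>a. parallel_sum Hf \<pi>f \<zeta>f Hg \<pi>g \<zeta>g a = 0"
    by (simp add: parallel_sum_eq S.hinner_zero_right S.rep_mem S.zero_mem)
qed

text \<open>The representing space lives over \<open>'v \<times> 'w\<close>;
  \<open>representableI\<close> carries it to the function type over which
  \<open>representable\<close> quantifies.\<close>

lemma representable_parallel_sum: "representable (parallel_sum Hf \<pi>f \<zeta>f Hg \<pi>g \<zeta>g)"
  by (rule representableI[OF S.hilbert_space_axioms S.star_representation \<xi>_mem parallel_sum_eq])

lemma parallel_sum_dominated_f: "parallel_sum Hf \<pi>f \<zeta>f Hg \<pi>g \<zeta>g \<preceq> f"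
  unfolding dominated_def
proof
  fix a
  have "hnorm (Hf \<oplus>\<^sub>H Hg) ((\<pi>f \<oplus>\<^sub>r \<pi>g) a \<xi>) \<le> hnorm (Hf \<oplus>\<^sub>H Hg) ((\<pi>f \<oplus>\<^sub>r \<pi>g) a (\<zeta>f, 0))"
    using S.hnorm_rep_le[OF \<zeta>_mem] \<xi>_orth \<zeta>f_diff_\<xi> by (simp add: M_eq)
  also have "\<dots> \<le> hnorm Hf (\<pi>f a \<zeta>f)"
    using hnorm_direct_sum_le(3)[OF F.pre_hilbert_space_axioms G.pre_hilbert_space_axioms
        F.rep_mem[OF \<zeta>f_mem] G.zero_mem]
    by (simp add: rep_sum_apply G.rep_vector_zero G.hnorm_zero)
  finally show "parallel_sum Hf \<pi>f \<zeta>f Hg \<pi>g \<zeta>g (a\<^sup>\<star> * a) \<le> f (a\<^sup>\<star> * a)"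
    using S.hinner_self(2)[OF S.rep_mem[OF \<xi>_mem], of a]
    by (simp add: parallel_sum_eq S.hinner_rep_star_mult_self \<xi>_mem f_star_mult less_eq_complex_def
        power_mono)
qed

lemma parallel_sum_dominated_g: "parallel_sum Hf \<pi>f \<zeta>f Hg \<pi>g \<zeta>g \<preceq> g"
  unfolding dominated_def
proof
  fix a
  \<comment> \<open>The bracket equals \<open>(0, \<zeta>g) + \<xi>\<close>. Modulo
    \<open>M\<close>, therefore, \<open>\<xi>\<close> may also be compared with
    \<open>(0, - \<zeta>g)\<close>, and the sign does not affect norms.\<close>
  have "- ((\<zeta>f, \<zeta>g) - ((\<zeta>f, 0) - \<xi>)) \<in> M"
    by (intro complex_vector.subspace_neg[OF subspace_M] complex_vector.subspace_diff[OF subspace_M]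
        \<zeta>_mem_M \<zeta>f_diff_\<xi>)
  then have "(0, - \<zeta>g) - \<xi> \<in> M"
    by (cases \<xi>) simp
  then have "hnorm (Hf \<oplus>\<^sub>H Hg) ((\<pi>f \<oplus>\<^sub>r \<pi>g) a \<xi>) \<le> hnorm (Hf \<oplus>\<^sub>H Hg) ((\<pi>f \<oplus>\<^sub>r \<pi>g) a (0, - \<zeta>g))"
    using S.hnorm_rep_le[OF \<zeta>_mem] \<xi>_orth by (simp add: M_eq)
  also have "\<dots> \<le> hnorm Hg (\<pi>g a \<zeta>g)"
    using hnorm_direct_sum_le(3)[OF F.pre_hilbert_space_axioms G.pre_hilbert_space_axioms
        F.zero_mem G.rep_mem[OF G.minus_mem[OF \<zeta>g_mem]]]
    by (simp add: rep_sum_apply F.rep_vector_zero F.hnorm_zero G.rep_vector_minus \<zeta>g_mem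
        G.hnorm_minus G.rep_mem)
  finally show "parallel_sum Hf \<pi>f \<zeta>f Hg \<pi>g \<zeta>g (a\<^sup>\<star> * a) \<le> g (a\<^sup>\<star> * a)"
    using S.hinner_self(2)[OF S.rep_mem[OF \<xi>_mem], of a]
    by (simp add: parallel_sum_eq S.hinner_rep_star_mult_self \<xi>_mem g_star_mult less_eq_complex_def
        power_mono)
qed

section \<open>Mutual singularity\<close>

lemma mutually_singular_imp_\<xi>_eq_0: "mutually_singular f g \<Longrightarrow> \<xi> = 0"
  using representable_parallel_sum parallel_sum_dominated_f parallel_sum_dominated_g
    parallel_sum_eq_0_iff unfolding mutually_singular_def by blast

lemma whole_imp_mutually_singular:
  assumes whole: "M = hcarrier (Hf \<oplus>\<^sub>H Hg)"
  shows "mutually_singular f g"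
  unfolding mutually_singular_def
proof (intro allI impI, elim conjE)
  fix h x assume "representable h" and hf: "h \<preceq> f" and hg: "h \<preceq> g"
  then obtain K :: "('a \<Rightarrow> complex) hspace" and \<rho> \<eta> where
    K: "hilbert_space K" "star_representation K \<rho>" and \<eta>: "\<eta> \<in> hcarrier K"
      and h: "\<And>a. h a = hinner K (\<rho> a \<eta>) \<eta>"
    unfolding representable_def by blast
  interpret K: hilbert_representation K \<rho>
    using K by (simp add: hilbert_representation_def hilbert_representation_axioms_def)
  have h_star: "h (a\<^sup>\<star> * a) = complex_of_real ((hnorm K (\<rho> a \<eta>))\<^sup>2)" for a
    using K.hinner_rep_star_mult_self[OF \<eta>] by (simp add: h)
  have le_f: "hnorm K (\<rho> a \<eta>) \<le> hnorm Hf (\<pi>f a \<zeta>f)" for a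
  proof (rule power2_le_imp_le)
    have "h (a\<^sup>\<star> * a) \<le> f (a\<^sup>\<star> * a)"
      using hf unfolding dominated_def by (rule spec)
    then show "(hnorm K (\<rho> a \<eta>))\<^sup>2 \<le> (hnorm Hf (\<pi>f a \<zeta>f))\<^sup>2"
      unfolding h_star f_star_mult by (simp add: less_eq_complex_def)
    show "0 \<le> hnorm Hf (\<pi>f a \<zeta>f)"
      using \<zeta>f_mem by (intro F.hinner_self(2) F.rep_mem)
  qed
  have le_g: "hnorm K (\<rho> a \<eta>) \<le> hnorm Hg (\<pi>g a \<zeta>g)" for a
  proof (rule power2_le_imp_le)
    have "h (a\<^sup>\<star> * a) \<le> g (a\<^sup>\<star> * a)"
      using hg unfolding dominated_def by (rule spec)
    then show "(hnorm K (\<rho> a \<eta>))\<^sup>2 \<le> (hnorm Hg (\<pi>g a \<zeta>g))\<^sup>2"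
      unfolding h_star g_star_mult by (simp add: less_eq_complex_def)
    show "0 \<le> hnorm Hg (\<pi>g a \<zeta>g)"
      using \<zeta>g_mem by (intro G.hinner_self(2) G.rep_mem)
  qed
  \<comment> \<open>This yields elements \<open>s n\<close> that are small with respect to
    \<open>f\<close> while \<open>s n - x\<close> is small with respect to \<open>g\<close>.\<close>
  have "(0, \<pi>g x \<zeta>g) \<in> M"
    by (simp add: whole hcarrier_direct_sum F.zero_mem G.rep_mem \<zeta>g_mem)
  then obtain s where s: "(\<lambda>n. hnorm Hf (\<pi>f (s n) \<zeta>f)) \<longlonglongrightarrow> 0"
      "(\<lambda>n. hnorm Hg (\<pi>g (s n) \<zeta>g - \<pi>g x \<zeta>g)) \<longlonglongrightarrow> 0"
    unfolding M_iff by auto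
  have "hnorm K (\<rho> x \<eta>) \<le> hnorm Hf (\<pi>f (s n) \<zeta>f) + hnorm Hg (\<pi>g (s n) \<zeta>g - \<pi>g x \<zeta>g)" for n
  proof -
    \<comment> \<open>Domination by \<open>f\<close> controls the first summand and domination by
      \<open>g\<close> the second.\<close>
    have "hnorm K (\<rho> x \<eta>) \<le> hnorm K (\<rho> (s n) \<eta>) + hnorm K (\<rho> (s n - x) \<eta>)"
      using K.hnorm_diff_triangle[of "\<rho> x \<eta>" "\<rho> (s n) \<eta>" 0] K.zero_mem
        K.hnorm_minus_commute[of "\<rho> (s n) \<eta>" "\<rho> x \<eta>"] \<eta>
      by (simp add: K.rep_mem K.rep_diff K.hnorm_minus)
    also have "\<dots> \<le> hnorm Hf (\<pi>f (s n) \<zeta>f) + hnorm Hg (\<pi>g (s n - x) \<zeta>g)"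
      using le_f[of "s n"] le_g[of "s n - x"] by simp
    finally show ?thesis
      by (simp add: G.rep_diff \<zeta>g_mem)
  qed
  then have "hnorm K (\<rho> x \<eta>) \<le> 0"
    using tendsto_add[OF s] by (intro LIMSEQ_le_const) auto
  then have "\<rho> x \<eta> = 0"
    using K.hinner_self(2,3)[OF K.rep_mem[OF \<eta>], of x] by simp
  then show "h x = 0"
    by (simp add: h K.hinner_zero_left \<eta>)
qed

section \<open>Exchanging the two functionals\<close>

lemma swap: "gns_pair g f Hg \<pi>g \<zeta>g Hf \<pi>f \<zeta>f"
  using gns_f gns_g by unfold_locales

lemma swap_mem_M: "(y, x) \<in> gns_graph_closure Hg \<pi>g \<zeta>g Hf \<pi>f \<zeta>f \<longleftrightarrow> (x, y) \<in> M"
  unfolding gns_pair.M_iff[OF swap] M_iff by blast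

text \<open>Once \<open>(\<zeta>f, 0)\<close> is in \<open>M\<close>, so is
  \<open>(0, \<zeta>g)\<close>. The slice lemma, applied also to the exchanged pair, puts both
  coordinate subspaces into \<open>M\<close>, and they span the sum.\<close>

lemma M_eq_whole_iff: "M = hcarrier (Hf \<oplus>\<^sub>H Hg) \<longleftrightarrow> (\<zeta>f, 0) \<in> M"
proof
  assume \<zeta>f: "(\<zeta>f, 0) \<in> M"
  have "(x, y) \<in> M" if xy: "x \<in> hcarrier Hf" "y \<in> hcarrier Hg" for x y
  proof -
    have "(\<zeta>g, 0) \<in> gns_graph_closure Hg \<pi>g \<zeta>g Hf \<pi>f \<zeta>f"
      using \<zeta>f by (simp add: swap_mem_M \<zeta>f_in_M_iff_\<zeta>g_in_M)
    then have "(0, y) \<in> M"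
      using gns_pair.slice_mem_M[OF swap _ xy(2)] by (simp add: swap_mem_M)
    then show ?thesis
      using complex_vector.subspace_add[OF subspace_M slice_mem_M[OF \<zeta>f xy(1)], of "(0, y)"] by simp
  qed
  then show "M = hcarrier (Hf \<oplus>\<^sub>H Hg)"
    using M_subset by (auto simp: hcarrier_direct_sum)
qed (simp add: \<zeta>f_0_mem)

end

theorem theorem5p2:
  fixes f g :: "'a::star_algebra \<Rightarrow> complex"
    and Hf :: "'v::complex_vector hspace" and \<pi>f :: "'a \<Rightarrow> 'v \<Rightarrow> 'v" and \<zeta>f :: 'v
    and Hg :: "'w::complex_vector hspace" and \<pi>g :: "'a \<Rightarrow> 'w \<Rightarrow> 'w" and \<zeta>g :: 'w
    and M :: "('v \<times> 'w) set"
  assumes "positive_functional f" and "representable f" and "gns_triple f Hf \<pi>f \<zeta>f"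
    and "positive_functional g" and "representable g" and "gns_triple g Hg \<pi>g \<zeta>g"
    and "M = gns_graph_closure Hf \<pi>f \<zeta>f Hg \<pi>g \<zeta>g"
  shows "((\<forall>a. parallel_sum Hf \<pi>f \<zeta>f Hg \<pi>g \<zeta>g a = 0) \<longleftrightarrow> (\<zeta>f, 0) \<in> M) \<and>
    ((\<zeta>f, 0) \<in> M \<longleftrightarrow> (0, \<zeta>g) \<in> M) \<and>
    ((0, \<zeta>g) \<in> M \<longleftrightarrow> M = hcarrier (Hf \<oplus>\<^sub>H Hg)) \<and>
    (M = hcarrier (Hf \<oplus>\<^sub>H Hg) \<longleftrightarrow> cyclic_vector (Hf \<oplus>\<^sub>H Hg) (\<pi>f \<oplus>\<^sub>r \<pi>g) (\<zeta>f, \<zeta>g)) \<and>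
    (cyclic_vector (Hf \<oplus>\<^sub>H Hg) (\<pi>f \<oplus>\<^sub>r \<pi>g) (\<zeta>f, \<zeta>g) \<longleftrightarrow> mutually_singular f g) \<and>
    (mutually_singular f g \<longleftrightarrow> semisingular f g) \<and>
    (semisingular f g \<longleftrightarrow> semisingular g f)"
proof -
  interpret gns_pair f g Hf \<pi>f \<zeta>f Hg \<pi>g \<zeta>g
    using assms by unfold_locales
  \<comment> \<open>Each assertion is reduced to \<open>(\<zeta>f, 0) \<in> M\<close>; this one uses
    \<open>semisingular_iff\<close> for the exchanged pair.\<close>
  have "semisingular g f \<longleftrightarrow> (\<zeta>f, 0) \<in> M"
    using gns_pair.semisingular_iff[OF swap] assms(7) by (simp add: swap_mem_M)
  moreover have "mutually_singular f g \<longleftrightarrow> (\<zeta>f, 0) \<in> M"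
    using mutually_singular_imp_\<xi>_eq_0 \<xi>_eq_0_iff whole_imp_mutually_singular M_eq_whole_iff assms(7)
    by blast
  ultimately show ?thesis
    using parallel_sum_eq_0_iff \<xi>_eq_0_iff \<zeta>f_in_M_iff_\<zeta>g_in_M M_eq_whole_iff
      M_eq_whole_iff_cyclic semisingular_iff assms(7)
    by simp
qed

end
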